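(* Let $\mathbb{F}$ be $\mathbb{R}$ or $\mathbb{C}$ and let $\omega$ be the exponent of matrix multiplication over $\mathbb{F}$. For every $\eta>0$ there exists an algorithm for multiplying $n\times n$ matrices over $\mathbb{F}$ which performs $O(n^{\omega+\eta})$ arithmetic operations and which is numerically stable in the following sense: there are a constant $c$ depending on $\eta$ but not on $n$, and a function $\mu(n)=O(n^c)$, such that for every $n$ and all $n\times n$ matrices $A,B$ with exact product $C=AB$, the output $C_{comp}$ of the algorithm executed in rounded arithmetic with machine precision $\varepsilon$ satisfies $$\|C_{comp}-C\|\le\mu(n)\,\varepsilon\,\|A\|\,\|B\|+O(\varepsilon^2),$$ where $\|M\|=\max_{i,j}|m_{ij}|$.
   Context: An algorithm is a family (one for each $n$) of branch-free (straight-line) programs / arithmetic circuits over $\mathbb{F}$ using the operations $\{+,-,\cdot\}$ and constants from $\mathbb{F}$, which takes the entries of $A$ and $B$ as inputs and outputs the exact entries of $AB$ in the absence of rounding errors. The exponent of matrix multiplication $\omega$ is the smallest real number such that for every $\eta>0$, $n\times n$ matrix multiplication can be performed in $O(n^{\omega+\eta})$ arithmetic operations. Rounded arithmetic: every execution of an operation $op\in\{+,-,\cdot\}$ (including multiplication by a constant) on operands $a,b$ returns $op(a,b)(1+\theta)$ with $|\theta|\le\varepsilon$, $\theta$ otherwise arbitrary and possibly different at each execution. The term $O(\varepsilon^2)$ refers to $\varepsilon\to0$ with $n$, $A$, $B$ and the algorithm fixed, uniformly over all choices of the errors $\theta$. *)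

theory Defs
  imports Complex_Main "HOL-Library.Landau_Symbols" "Jordan_Normal_Form.Matrix"
begin

datatype arith_op = Add | Sub | Mul

datatype 'a operand = Const 'a | InA nat nat | InB nat nat | Reg nat

datatype 'a instr = Instr (oper: arith_op) (arg1: "'a operand") (arg2: "'a operand")

text \<open>The \<open>k\<close>-th instruction writes register \<open>k\<close>. The entry \<open>(i, j)\<close> of the result is read off
  the operand \<open>outs P i j\<close> (relevant only for indices below the matrix dimension), at no cost and
  without rounding.\<close>

datatype 'a slp = SLP (instrs: "'a instr list") (outs: "nat \<Rightarrow> nat \<Rightarrow> 'a operand")

fun wf_operand :: "nat \<Rightarrow> nat \<Rightarrow> 'a operand \<Rightarrow> bool" where
  "wf_operand n k (Const c) \<longleftrightarrow> True"
| "wf_operand n k (InA i j) \<longleftrightarrow> i < n \<and> j < n"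
| "wf_operand n k (InB i j) \<longleftrightarrow> i < n \<and> j < n"
| "wf_operand n k (Reg r) \<longleftrightarrow> r < k"

definition wf_slp :: "nat \<Rightarrow> 'a slp \<Rightarrow> bool" where
  "wf_slp n P \<longleftrightarrow>
     (\<forall>k < length (instrs P). wf_operand n k (arg1 (instrs P ! k)) \<and> wf_operand n k (arg2 (instrs P ! k))) \<and>
     (\<forall>i < n. \<forall>j < n. wf_operand n (length (instrs P)) (outs P i j))"

definition op_count :: "'a slp \<Rightarrow> nat" where
  "op_count P = length (instrs P)"

fun apply_op :: "arith_op \<Rightarrow> 'a::comm_ring_1 \<Rightarrow> 'a \<Rightarrow> 'a" where
  "apply_op Add x y = x + y"
| "apply_op Sub x y = x - y"
| "apply_op Mul x y = x * y"

fun operand_val :: "'a mat \<Rightarrow> 'a mat \<Rightarrow> 'a list \<Rightarrow> 'a operand \<Rightarrow> 'a" where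
  "operand_val A B regs (Const c) = c"
| "operand_val A B regs (InA i j) = A $$ (i, j)"
| "operand_val A B regs (InB i j) = B $$ (i, j)"
| "operand_val A B regs (Reg r) = regs ! r"

text \<open>\<open>\<theta> k\<close> is the relative error committed by instruction \<open>k\<close>; \<open>length regs\<close> is the index of the
  instruction being executed.\<close>

fun run_instrs :: "(nat \<Rightarrow> 'a::comm_ring_1) \<Rightarrow> 'a mat \<Rightarrow> 'a mat \<Rightarrow> 'a list \<Rightarrow> 'a instr list \<Rightarrow> 'a list" where
  "run_instrs \<theta> A B regs [] = regs"
| "run_instrs \<theta> A B regs (Instr f x y # is) =
     run_instrs \<theta> A B
       (regs @ [apply_op f (operand_val A B regs x) (operand_val A B regs y) * (1 + \<theta> (length regs))]) is"

definition rounded_output :: "(nat \<Rightarrow> 'a::comm_ring_1) \<Rightarrow> nat \<Rightarrow> 'a slp \<Rightarrow> 'a mat \<Rightarrow> 'a mat \<Rightarrow> 'a mat" where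
  "rounded_output \<theta> n P A B =
     mat n n (\<lambda>(i, j). operand_val A B (run_instrs \<theta> A B [] (instrs P)) (outs P i j))"

definition exact_output :: "nat \<Rightarrow> 'a::comm_ring_1 slp \<Rightarrow> 'a mat \<Rightarrow> 'a mat \<Rightarrow> 'a mat" where
  "exact_output = rounded_output (\<lambda>_. 0)"

definition mm_algorithm :: "(nat \<Rightarrow> 'a::comm_ring_1 slp) \<Rightarrow> bool" where
  "mm_algorithm P \<longleftrightarrow>
     (\<forall>n. wf_slp n (P n) \<and>
          (\<forall>A \<in> carrier_mat n n. \<forall>B \<in> carrier_mat n n. exact_output n (P n) A B = A * B))"

definition ops_bigo :: "(nat \<Rightarrow> 'a slp) \<Rightarrow> real \<Rightarrow> bool" where
  "ops_bigo P w \<longleftrightarrow> (\<lambda>n. real (op_count (P n))) \<in> O(\<lambda>n. real n powr w)"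

definition mm_exponent :: "'a::comm_ring_1 itself \<Rightarrow> real" where
  "mm_exponent _ =
     (LEAST w::real. \<forall>\<eta>>0. \<exists>P :: nat \<Rightarrow> 'a slp. mm_algorithm P \<and> ops_bigo P (w + \<eta>))"

text \<open>Inserting \<open>0\<close> only matters for the empty matrix.\<close>

definition max_norm :: "'a::real_normed_field mat \<Rightarrow> real" where
  "max_norm M = Max (insert 0 (norm ` elements_mat M))"

text \<open>The remainder \<open>R\<close> may depend on \<open>n\<close>, \<open>A\<close>, \<open>B\<close> and the algorithm, but not on the errors \<open>\<theta>\<close>.\<close>

definition numerically_stable :: "(nat \<Rightarrow> 'a::real_normed_field slp) \<Rightarrow> bool" where
  "numerically_stable P \<longleftrightarrow>
     (\<exists>(c::real) (\<mu> :: nat \<Rightarrow> real).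
        \<mu> \<in> O(\<lambda>n. real n powr c) \<and>
        (\<forall>n. \<forall>A \<in> carrier_mat n n. \<forall>B \<in> carrier_mat n n.
           \<exists>R \<in> O[at_right 0](\<lambda>\<epsilon>::real. \<epsilon>\<^sup>2).
             \<forall>\<epsilon>>0. \<forall>\<theta> :: nat \<Rightarrow> 'a. (\<forall>k. norm (\<theta> k) \<le> \<epsilon>) \<longrightarrow>
               max_norm (rounded_output \<theta> n (P n) A B - A * B)
                 \<le> \<mu> n * \<epsilon> * max_norm A * max_norm B + R \<epsilon>))"

end

theory Submission imports Defs begin

text \<open>A straight-line program for \<open>m \<times> m\<close> matrices with few operations yields a bilinear algorithm:
  the bilinear part of a register is the mixed derivative of its value at \<open>(\<sigma> A, \<tau> B)\<close>, and each
  multiplication adds at most two products of linear forms to the span of these parts. For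
  large fixed \<open>m\<close>, recursive use of this bilinear algorithm on block matrices has the required cost,
  since \<open>\<omega> \<ge> 2\<close> makes the cost of the linear combinations negligible.

  For stability, every computed value \<open>v'\<close> is accompanied by a bound \<open>m \<ge> |v|\<close> and a number of
  roundings \<open>d\<close> with \<open>|v' - v| \<le> m ((1 + \<epsilon>)^d - 1)\<close>. In a recursion step the bounds are multiplied by
  a constant and \<open>d\<close> grows by a constant. After \<open>k = O(log n)\<close> levels the bound is thus polynomial
  in \<open>n\<close> and \<open>d\<close> is logarithmic. The case \<open>\<epsilon> = 0\<close> is the correctness of the algorithm.\<close>


section \<open>Splitting an index into quotient and remainder\<close>

lemma sum_div_mod:
  fixes g :: "nat \<Rightarrow> 'a::comm_monoid_add"
  shows "(\<Sum>l<a * b. g l) = (\<Sum>p<a. \<Sum>q<b. g (p * b + q))"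
proof -
  have *: "sum g {p * b..<p * b + b} = (\<Sum>q<b. g (p * b + q))" for p
    using sum.shift_bounds_nat_ivl [of g 0 "p * b" b]
    by (simp add: atLeast0LessThan add.commute)
  have "(\<Sum>l<a * b. g l) = (\<Sum>p<a. sum g {p * b..<p * b + b})"
    by (rule sum.nat_group [symmetric])
  also have "\<dots> = (\<Sum>p<a. \<Sum>q<b. g (p * b + q))"
    by (simp only: *)
  finally show ?thesis .
qed

lemma mult_add_less: "(p::nat) < a \<Longrightarrow> q < b \<Longrightarrow> p * b + q < a * b"
proof -
  assume "p < a" "q < b"
  then have "p * b + q < Suc p * b" "Suc p * b \<le> a * b"
    by (simp, intro mult_le_mono) auto
  then show ?thesis
    by linarith
qed

section \<open>Relative error calculus\<close>

text \<open>The bound \<open>m\<close> is on the exact value, not on the computed one. The factor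
  \<open>(1 + \<epsilon>) ^ d - 1\<close> keeps all higher-order terms, so the rules below compose
  without loss and the expansion in \<epsilon> is done only once, at the end.\<close>

definition appr :: "real \<Rightarrow> 'a::real_normed_field \<Rightarrow> 'a \<Rightarrow> real \<Rightarrow> nat \<Rightarrow> bool" where
  "appr \<epsilon> v' v m d \<longleftrightarrow> norm (v' - v) \<le> m * ((1 + \<epsilon>) ^ d - 1) \<and> norm v \<le> m"

lemma appr_refl: "norm v \<le> m \<Longrightarrow> appr \<epsilon> v v m 0"
  by (simp add: appr_def)

lemma appr_mono:
  assumes "appr \<epsilon> v' v m d" "m \<le> m'" "d \<le> d'" "\<epsilon> \<ge> 0"
  shows "appr \<epsilon> v' v m' d'"
proof -
  have "0 \<le> m" "1 \<le> (1 + \<epsilon>) ^ d" "(1 + \<epsilon>) ^ d \<le> (1 + \<epsilon>) ^ d'"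
    using assms order_trans [OF norm_ge_zero] by (auto simp: appr_def power_increasing)
  then have "m * ((1 + \<epsilon>) ^ d - 1) \<le> m' * ((1 + \<epsilon>) ^ d' - 1)"
    using assms by (intro mult_mono) auto
  then show ?thesis
    using assms by (auto simp: appr_def)
qed

lemma appr_norm:
  assumes "appr \<epsilon> v' v m d"
  shows "norm v' \<le> m * (1 + \<epsilon>) ^ d"
  using assms norm_triangle_ineq [of "v' - v" v] by (auto simp: appr_def algebra_simps)

text \<open>The error splits as \<open>(v' - v) + \<theta> * v'\<close>. The two bounds
  \<open>m * ((1 + \<epsilon>) ^ d - 1)\<close> and
  \<open>\<epsilon> * m * (1 + \<epsilon>) ^ d\<close> add up to exactly
  \<open>m * ((1 + \<epsilon>) ^ Suc d - 1)\<close>.\<close>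

lemma appr_round:
  assumes "appr \<epsilon> v' v m d" "norm \<theta> \<le> \<epsilon>"
  shows "appr \<epsilon> (v' * (1 + \<theta>)) v m (Suc d)"
proof -
  have "norm (v' * (1 + \<theta>) - v) \<le> norm (v' - v) + norm (\<theta> * v')"
    using norm_triangle_ineq [of "v' - v" "\<theta> * v'"] by (simp add: algebra_simps)
  also have "\<dots> \<le> m * ((1 + \<epsilon>) ^ d - 1) + \<epsilon> * (m * (1 + \<epsilon>) ^ d)"
    using assms appr_norm [OF assms(1)] order_trans [OF norm_ge_zero assms(2)]
    by (intro add_mono) (auto simp: appr_def norm_mult intro!: mult_mono)
  finally show ?thesis
    using assms by (simp add: appr_def algebra_simps)
qed

lemma appr_add:
  assumes "appr \<epsilon> v' v m d" "appr \<epsilon> w' w l d"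
  shows "appr \<epsilon> (v' + w') (v + w) (m + l) d"
proof -
  have "norm (v' + w' - (v + w)) \<le> norm (v' - v) + norm (w' - w)"
    using norm_triangle_ineq [of "v' - v" "w' - w"] by (simp add: algebra_simps)
  moreover have "norm (v + w) \<le> norm v + norm w"
    by (rule norm_triangle_ineq)
  ultimately show ?thesis
    using assms by (auto simp: appr_def algebra_simps)
qed

text \<open>In \<open>v' * w' - v * w = (v' - v) * w' + v * (w' - w)\<close> the computed
  \<open>w'\<close> is bounded by \<open>appr_norm\<close>; the two terms then telescope to the
  exponent \<open>d + e\<close>.\<close>

lemma appr_mult:
  assumes "appr \<epsilon> v' v m d" "appr \<epsilon> w' w l e" "\<epsilon> \<ge> 0"
  shows "appr \<epsilon> (v' * w') (v * w) (m * l) (d + e)"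
proof -
  have nn: "0 \<le> m"
    using assms order_trans [OF norm_ge_zero] by (auto simp: appr_def)
  have "norm (v' * w' - v * w) \<le> norm ((v' - v) * w') + norm (v * (w' - w))"
    using norm_triangle_ineq [of "(v' - v) * w'" "v * (w' - w)"] by (simp add: algebra_simps)
  also have "\<dots> \<le> (m * ((1 + \<epsilon>) ^ d - 1)) * (l * (1 + \<epsilon>) ^ e) + m * (l * ((1 + \<epsilon>) ^ e - 1))"
    using assms appr_norm [OF assms(2)] nn
    by (intro add_mono) (auto simp: appr_def norm_mult intro!: mult_mono)
  also have "\<dots> = m * l * ((1 + \<epsilon>) ^ (d + e) - 1)"
    by (simp add: algebra_simps power_add)
  finally show ?thesis
    using assms nn by (auto simp: appr_def norm_mult intro!: mult_mono)
qed

section \<open>Prefixes of straight-line programs\<close>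

text \<open>This is the instruction part of \<open>wf_slp\<close>. Programs are grown by appending
  instructions before any outputs are chosen.\<close>

definition wf_prefix :: "nat \<Rightarrow> 'a instr list \<Rightarrow> bool" where
  "wf_prefix n is \<longleftrightarrow>
     (\<forall>k < length is. wf_operand n k (arg1 (is ! k)) \<and> wf_operand n k (arg2 (is ! k)))"

definition rval :: "(nat \<Rightarrow> 'a::comm_ring_1) \<Rightarrow> 'a mat \<Rightarrow> 'a mat \<Rightarrow> 'a instr list \<Rightarrow> 'a operand \<Rightarrow> 'a" where
  "rval \<theta> A B is x = operand_val A B (run_instrs \<theta> A B [] is) x"

lemma wf_prefix_Nil [simp]: "wf_prefix n []"
  by (simp add: wf_prefix_def)

lemma wf_prefix_snoc:
  "wf_prefix n (is @ [Instr f x y]) \<longleftrightarrow>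
     wf_prefix n is \<and> wf_operand n (length is) x \<and> wf_operand n (length is) y"
  by (auto simp: wf_prefix_def nth_append less_Suc_eq)

lemma wf_operand_mono: "wf_operand n k x \<Longrightarrow> k \<le> l \<Longrightarrow> wf_operand n l x"
  by (cases x) auto

lemma run_instrs_append:
  "run_instrs \<theta> A B regs (is @ js) = run_instrs \<theta> A B (run_instrs \<theta> A B regs is) js"
  by (induction \<theta> A B regs "is" rule: run_instrs.induct) auto

lemma length_run_instrs [simp]:
  "length (run_instrs \<theta> A B regs is) = length regs + length is"
  by (induction \<theta> A B regs "is" rule: run_instrs.induct) auto

lemma nth_run_instrs:
  "r < length regs \<Longrightarrow> run_instrs \<theta> A B regs is ! r = regs ! r"
  by (induction \<theta> A B regs "is" rule: run_instrs.induct) (auto simp: nth_append)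

text \<open>Registers are never overwritten, and a well-formed operand refers only to registers that
  are already written.\<close>

lemma rval_append:
  "wf_operand n (length is) x \<Longrightarrow> rval \<theta> A B (is @ js) x = rval \<theta> A B is x"
  by (cases x) (auto simp: rval_def run_instrs_append nth_run_instrs)

lemma rval_simps [simp]:
  "rval \<theta> A B is (Const c) = c"
  "rval \<theta> A B is (InA i j) = A $$ (i, j)"
  "rval \<theta> A B is (InB i j) = B $$ (i, j)"
  by (auto simp: rval_def)

lemma rval_snoc:
  "rval \<theta> A B (is @ [Instr f x y]) (Reg (length is)) =
     apply_op f (rval \<theta> A B is x) (rval \<theta> A B is y) * (1 + \<theta> (length is))"
  by (simp add: rval_def run_instrs_append nth_append)

text \<open>This is the invariant of the program construction. The bound \<open>m\<close> may depend
  on the inputs, while \<open>d\<close> is the same for all inputs and all rounding errors.\<close>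

definition approximates ::
  "nat \<Rightarrow> 'a::real_normed_field instr list \<Rightarrow> 'a operand \<Rightarrow> ('a mat \<Rightarrow> 'a mat \<Rightarrow> 'a) \<Rightarrow>
     ('a mat \<Rightarrow> 'a mat \<Rightarrow> real) \<Rightarrow> nat \<Rightarrow> bool" where
  "approximates n is x f m d \<longleftrightarrow> wf_operand n (length is) x \<and>
     (\<forall>\<epsilon> \<theta>. \<forall>A \<in> carrier_mat n n. \<forall>B \<in> carrier_mat n n. \<epsilon> \<ge> 0 \<longrightarrow> (\<forall>k. norm (\<theta> k) \<le> \<epsilon>) \<longrightarrow>
        appr \<epsilon> (rval \<theta> A B is x) (f A B) (m A B) d)"

lemma approximates_append:
  "approximates n is x f m d \<Longrightarrow> approximates n (is @ js) x f m d"
  by (auto simp: approximates_def rval_append intro: wf_operand_mono)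

lemma approximates_mono:
  fixes x :: "'a::real_normed_field operand"
  assumes "approximates n is x f m d" "d \<le> d'"
    and "\<And>A B. A \<in> carrier_mat n n \<Longrightarrow> B \<in> carrier_mat n n \<Longrightarrow> 0 \<le> m A B \<Longrightarrow> m A B \<le> m' A B"
  shows "approximates n is x f m' d'"
  unfolding approximates_def
proof (intro conjI allI ballI impI)
  show "wf_operand n (length is) x"
    using assms(1) by (simp add: approximates_def)
next
  fix \<epsilon> :: real and \<theta> :: "nat \<Rightarrow> 'a" and A B :: "'a mat"
  assume *: "A \<in> carrier_mat n n" "B \<in> carrier_mat n n" "0 \<le> \<epsilon>" "\<forall>k. norm (\<theta> k) \<le> \<epsilon>"
  then have a: "appr \<epsilon> (rval \<theta> A B is x) (f A B) (m A B) d"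
    using assms(1) by (simp add: approximates_def)
  then have "0 \<le> m A B"
    using order_trans [OF norm_ge_zero] by (auto simp: appr_def)
  then show "appr \<epsilon> (rval \<theta> A B is x) (f A B) (m' A B) d'"
    using a * assms(2,3) by (blast intro: appr_mono)
qed

lemma approximates_cong:
  assumes "approximates n is x f m d"
    and "\<And>A B. A \<in> carrier_mat n n \<Longrightarrow> B \<in> carrier_mat n n \<Longrightarrow> f A B = g A B"
  shows "approximates n is x g m d"
  using assms by (auto simp: approximates_def)

lemma approximates_add:
  assumes "approximates n is x f m d" "approximates n is y g l d" "wf_prefix n is"
  shows "wf_prefix n (is @ [Instr Add x y])"
    and "approximates n (is @ [Instr Add x y]) (Reg (length is))
      (\<lambda>A B. f A B + g A B) (\<lambda>A B. m A B + l A B) (Suc d)"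
  using assms by (auto simp: approximates_def wf_prefix_snoc rval_snoc intro!: appr_round appr_add)

lemma approximates_mult:
  assumes "approximates n is x f m d" "approximates n is y g l e" "wf_prefix n is"
  shows "wf_prefix n (is @ [Instr Mul x y])"
    and "approximates n (is @ [Instr Mul x y]) (Reg (length is))
      (\<lambda>A B. f A B * g A B) (\<lambda>A B. m A B * l A B) (Suc (d + e))"
  using assms by (auto simp: approximates_def wf_prefix_snoc rval_snoc intro!: appr_round appr_mult)

lemma approximates_Const: "approximates n is (Const c) (\<lambda>A B. c) (\<lambda>A B. norm c) 0"
  by (auto simp: approximates_def intro!: appr_refl)

text \<open>A running sum, with one multiplication by a constant and one addition per term. The
  multiplication contributes 1 to the exponent and the additions contribute
  \<open>q\<close>.\<close>

lemma approximates_linear_combination: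
  assumes "wf_prefix n is" and "\<And>i. i < q \<Longrightarrow> approximates n is (x i) (f i) m d"
  shows "\<exists>js z. wf_prefix n (is @ js) \<and> length js \<le> 2 * q \<and>
    approximates n (is @ js) z (\<lambda>A B. \<Sum>i<q. c i * f i A B)
      (\<lambda>A B. (\<Sum>i<q. norm (c i)) * m A B) (d + 1 + q)"
  using assms(2)
proof (induction q)
  case 0
  show ?case
    using assms(1) approximates_Const [of n "is" 0]
    by (intro exI [of _ "[]"] exI [of _ "Const 0"]) (auto intro: approximates_mono)
next
  case (Suc q)
  then obtain js z where js: "wf_prefix n (is @ js)" "length js \<le> 2 * q"
    and z: "approximates n (is @ js) z (\<lambda>A B. \<Sum>i<q. c i * f i A B)
      (\<lambda>A B. (\<Sum>i<q. norm (c i)) * m A B) (d + 1 + q)"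
    by auto
  have "approximates n (is @ js) (x q) (f q) m d"
    using Suc.prems by (intro approximates_append) auto
  note mul = approximates_mult [OF approximates_Const [of n "is @ js" "c q"] this js(1)]
  let ?ks = "(is @ js) @ [Instr Mul (Const (c q)) (x q)]"
  \<comment> \<open>The exponent of the new product is raised to that of the partial sum, because
    \<open>approximates_add\<close> needs equal exponents.\<close>
  have "approximates n ?ks (Reg (length (is @ js)))
      (\<lambda>A B. c q * f q A B) (\<lambda>A B. norm (c q) * m A B) (d + 1 + q)"
    by (rule approximates_mono [OF mul(2)]) auto
  note add = approximates_add [OF approximates_append [OF z] this mul(1)]
  show ?case
    using add js(2)
    by (intro exI [of _ "js @ [Instr Mul (Const (c q)) (x q), Instr Add z (Reg (length (is @ js)))]"]
        exI [of _ "Reg (length ?ks)"]) (simp add: distrib_right)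
qed

text \<open>The programs for the different \<open>t\<close> run one after another. Hence
  \<open>step\<close> must work after any extension \<open>ks\<close>, and \<open>persist\<close>
  keeps the earlier results valid.\<close>

lemma extend_family:
  assumes "wf_prefix n is"
    and step: "\<And>t ks. t < T \<Longrightarrow> wf_prefix n (is @ ks) \<Longrightarrow>
      \<exists>js z. wf_prefix n ((is @ ks) @ js) \<and> length js \<le> c \<and> \<Phi> t ((is @ ks) @ js) z"
    and persist: "\<And>t ks js z. \<Phi> t ks z \<Longrightarrow> \<Phi> t (ks @ js) z"
  shows "\<exists>js Z. wf_prefix n (is @ js) \<and> length js \<le> T * c \<and> (\<forall>t<T. \<Phi> t (is @ js) (Z t))"
  using step
proof (induction T)
  case 0
  then show ?case
    using assms(1) by (intro exI [of _ "[]"]) auto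
next
  case (Suc T)
  then obtain ks Z where ks: "wf_prefix n (is @ ks)" "length ks \<le> T * c"
    and Z: "\<And>t. t < T \<Longrightarrow> \<Phi> t (is @ ks) (Z t)"
    by (metis less_SucI)
  obtain js z where js: "wf_prefix n ((is @ ks) @ js)" "length js \<le> c" "\<Phi> T ((is @ ks) @ js) z"
    using Suc.prems [of T ks] ks by auto
  show ?case
    using ks js persist [OF Z, of _ js]
    by (intro exI [of _ "ks @ js"] exI [of _ "Z(T := z)"]) (auto simp: less_Suc_eq)
qed

text \<open>The pairs are enumerated as \<open>t = i * N + j\<close> to reduce to a family with one
  index.\<close>

lemma extend_matrix_family:
  assumes "wf_prefix n is"
    and step: "\<And>i j ks. i < N \<Longrightarrow> j < N \<Longrightarrow> wf_prefix n (is @ ks) \<Longrightarrow>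
      \<exists>js z. wf_prefix n ((is @ ks) @ js) \<and> length js \<le> c \<and> \<Phi> i j ((is @ ks) @ js) z"
    and persist: "\<And>i j ks js z. \<Phi> i j ks z \<Longrightarrow> \<Phi> i j (ks @ js) z"
  shows "\<exists>js Z. wf_prefix n (is @ js) \<and> length js \<le> N * N * c \<and>
    (\<forall>i<N. \<forall>j<N. \<Phi> i j (is @ js) (Z i j))"
proof -
  have "\<exists>js Z. wf_prefix n (is @ js) \<and> length js \<le> N * N * c \<and>
    (\<forall>t<N * N. \<Phi> (t div N) (t mod N) (is @ js) (Z t))"
  proof (rule extend_family)
    fix t ks assume "t < N * N" "wf_prefix n (is @ ks)"
    moreover from this have "t div N < N" "t mod N < N"
      by (auto simp: less_mult_imp_div_less intro!: mod_less_divisor gr0I)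
    ultimately show "\<exists>js z. wf_prefix n ((is @ ks) @ js) \<and> length js \<le> c \<and>
        \<Phi> (t div N) (t mod N) ((is @ ks) @ js) z"
      using step by blast
  qed (use assms in auto)
  then obtain js Z where js: "wf_prefix n (is @ js)" "length js \<le> N * N * c"
    and Z: "\<And>t. t < N * N \<Longrightarrow> \<Phi> (t div N) (t mod N) (is @ js) (Z t)"
    by blast
  have "\<Phi> i j (is @ js) (Z (i * N + j))" if "i < N" "j < N" for i j
    using Z [OF mult_add_less [OF that]] that by simp
  then show ?thesis
    using js by (intro exI [of _ js] exI [of _ "\<lambda>i j. Z (i * N + j)"]) auto
qed


section \<open>Recursive use of a bilinear algorithm\<close>

text \<open>A decomposition of the \<open>m \<times> m\<close> matrix multiplication tensor into
  \<open>R\<close> rank-one terms. The index \<open>t\<close> stands for the matrix position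
  \<open>(t div m, t mod m)\<close>.\<close>

definition bilinear_mm ::
  "nat \<Rightarrow> nat \<Rightarrow> (nat \<Rightarrow> nat \<Rightarrow> 'a::comm_ring_1) \<Rightarrow> (nat \<Rightarrow> nat \<Rightarrow> 'a) \<Rightarrow> (nat \<Rightarrow> nat \<Rightarrow> nat \<Rightarrow> 'a) \<Rightarrow> bool" where
  "bilinear_mm m R u v w \<longleftrightarrow>
     (\<forall>a b i j. i < m \<longrightarrow> j < m \<longrightarrow>
        (\<Sum>l<m. a i l * b l j) =
        (\<Sum>r<R. w i j r * ((\<Sum>t<m * m. u r t * a (t div m) (t mod m)) *
                             (\<Sum>t<m * m. v r t * b (t div m) (t mod m)))))"

text \<open>The identity of scalars suffices for block matrices: it is applied to the \<open>m \<times> m\<close> matrices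
  formed by the entries at a fixed position of each block, and then summed over the inner index.\<close>

lemma bilinear_mm_blocks:
  assumes "bilinear_mm m R u v w" "i < m" "j < m"
  shows "(\<Sum>r<R. w i j r * (\<Sum>l<N.
       (\<Sum>t<m * m. u r t * a ((t div m) * N + p) ((t mod m) * N + l)) *
       (\<Sum>t<m * m. v r t * b ((t div m) * N + l) ((t mod m) * N + q)))) =
     (\<Sum>l<m * N. a (i * N + p) l * b l (j * N + q))"
proof -
  have "(\<Sum>l<m * N. a (i * N + p) l * b l (j * N + q)) =
      (\<Sum>l<N. \<Sum>k<m. a (i * N + p) (k * N + l) * b (k * N + l) (j * N + q))"
    unfolding sum_div_mod by (rule sum.swap)
  also have "\<dots> = (\<Sum>l<N. \<Sum>r<R. w i j r *
       ((\<Sum>t<m * m. u r t * a ((t div m) * N + p) ((t mod m) * N + l)) *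
        (\<Sum>t<m * m. v r t * b ((t div m) * N + l) ((t mod m) * N + q))))"
  proof (rule sum.cong [OF refl])
    fix l
    show "(\<Sum>k<m. a (i * N + p) (k * N + l) * b (k * N + l) (j * N + q)) = (\<Sum>r<R. w i j r *
       ((\<Sum>t<m * m. u r t * a ((t div m) * N + p) ((t mod m) * N + l)) *
        (\<Sum>t<m * m. v r t * b ((t div m) * N + l) ((t mod m) * N + q))))"
      using assms(1) [unfolded bilinear_mm_def, rule_format, OF assms(2,3),
          of "\<lambda>x y. a (x * N + p) (y * N + l)" "\<lambda>x y. b (x * N + l) (y * N + q)"] by simp
  qed
  also have "\<dots> = (\<Sum>r<R. \<Sum>l<N. w i j r *
       ((\<Sum>t<m * m. u r t * a ((t div m) * N + p) ((t mod m) * N + l)) *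
        (\<Sum>t<m * m. v r t * b ((t div m) * N + l) ((t mod m) * N + q))))"
    by (rule sum.swap)
  finally show ?thesis
    by (simp only: sum_distrib_left [where r = "w i j _"])
qed

text \<open>A linear combination of \<open>q\<close> terms costs \<open>2 * q\<close>. Each of the
  \<open>R\<close> recursive products needs two matrices of combinations of \<open>m * m\<close>
  blocks, and every entry of the result combines \<open>R\<close> products.\<close>

fun rec_cost :: "nat \<Rightarrow> nat \<Rightarrow> nat \<Rightarrow> nat" where
  "rec_cost m R 0 = 1"
| "rec_cost m R (Suc k) =
     R * (2 * (m ^ k * m ^ k * (2 * (m * m))) + rec_cost m R k) + m ^ Suc k * m ^ Suc k * (2 * R)"

text \<open>The \<open>max 0\<close> makes the bound nonnegative for every input, so that the
  coefficient sums can be replaced by their uniform bound \<open>M\<close>.\<close>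

lemma approximates_linear_combination_matrix:
  fixes c :: "nat \<Rightarrow> nat \<Rightarrow> nat \<Rightarrow> 'a::real_normed_field"
  assumes "wf_prefix n is"
    and "\<And>i j t. i < N \<Longrightarrow> j < N \<Longrightarrow> t < q \<Longrightarrow> approximates n is (x i j t) (f i j t) m d"
    and "\<And>i j. i < N \<Longrightarrow> j < N \<Longrightarrow> (\<Sum>t<q. norm (c i j t)) \<le> M"
  shows "\<exists>js Z. wf_prefix n (is @ js) \<and> length js \<le> N * N * (2 * q) \<and>
    (\<forall>i<N. \<forall>j<N. approximates n (is @ js) (Z i j) (\<lambda>A B. \<Sum>t<q. c i j t * f i j t A B)
      (\<lambda>A B. M * max 0 (m A B)) (d + 1 + q))"
proof (rule extend_matrix_family)
  fix i j ks assume *: "i < N" "j < N" "wf_prefix n (is @ ks)"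
  then have "\<And>t. t < q \<Longrightarrow> approximates n (is @ ks) (x i j t) (f i j t) (\<lambda>A B. max 0 (m A B)) d"
    using approximates_mono [OF assms(2), of i j _ d "\<lambda>A B. max 0 (m A B)"]
    by (intro approximates_append) auto
  from approximates_linear_combination [OF *(3), where q = q and x = "x i j" and f = "f i j" and c = "c i j", OF this]
  obtain js z where js: "wf_prefix n ((is @ ks) @ js)" "length js \<le> 2 * q"
    and z: "approximates n ((is @ ks) @ js) z (\<lambda>A B. \<Sum>t<q. c i j t * f i j t A B)
      (\<lambda>A B. (\<Sum>t<q. norm (c i j t)) * max 0 (m A B)) (d + 1 + q)"
    by blast
  have "approximates n ((is @ ks) @ js) z (\<lambda>A B. \<Sum>t<q. c i j t * f i j t A B)
      (\<lambda>A B. M * max 0 (m A B)) (d + 1 + q)"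
    using assms(3) [OF *(1,2)] by (intro approximates_mono [OF z]) (auto intro!: mult_right_mono)
  then show "\<exists>js z. wf_prefix n ((is @ ks) @ js) \<and> length js \<le> 2 * q \<and>
      approximates n ((is @ ks) @ js) z (\<lambda>A B. \<Sum>t<q. c i j t * f i j t A B)
      (\<lambda>A B. M * max 0 (m A B)) (d + 1 + q)"
    using js by blast
qed (use assms approximates_append in blast)+

text \<open>Induction on the number of levels. A level multiplies the bound by \<open>M\<close>
  three times: for the left factors, the right factors and the recombination. The inputs are
  arbitrary approximated functions, so that the induction hypothesis applies to linear combinations
  of blocks. An increase of \<open>d\<close> at the inputs enters the result only twice, which keeps
  the exponent linear in \<open>k\<close>.\<close>

lemma approximates_matrix_product:
  fixes u :: "nat \<Rightarrow> nat \<Rightarrow> 'a::real_normed_field" and X :: "nat \<Rightarrow> nat \<Rightarrow> 'a operand"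
  assumes bil: "bilinear_mm m R u v w" and "M \<ge> 0"
    and u: "\<And>r. r < R \<Longrightarrow> (\<Sum>t<m * m. norm (u r t)) \<le> M"
    and v: "\<And>r. r < R \<Longrightarrow> (\<Sum>t<m * m. norm (v r t)) \<le> M"
    and w: "\<And>i j. i < m \<Longrightarrow> j < m \<Longrightarrow> (\<Sum>r<R. norm (w i j r)) \<le> M"
    and "wf_prefix n is"
    and "\<And>A B. x A B \<ge> 0" "\<And>A B. y A B \<ge> 0"
    and "\<And>i j. i < m ^ k \<Longrightarrow> j < m ^ k \<Longrightarrow> approximates n is (X i j) (a i j) x d"
    and "\<And>i j. i < m ^ k \<Longrightarrow> j < m ^ k \<Longrightarrow> approximates n is (Y i j) (b i j) y d"
  shows "\<exists>js Z. wf_prefix n (is @ js) \<and> length js \<le> rec_cost m R k \<and>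
    (\<forall>i<m ^ k. \<forall>j<m ^ k. approximates n (is @ js) (Z i j)
      (\<lambda>A B. \<Sum>l<m ^ k. a i l A B * b l j A B)
      (\<lambda>A B. M ^ (3 * k) * (x A B * y A B)) (2 * d + (2 * m * m + R + 3) * k + 1))"
  using assms(6-)
proof (induction k arbitrary: "is" x y X Y a b d)
  case 0
  from 0(4,5) have "approximates n is (X 0 0) (a 0 0) x d" "approximates n is (Y 0 0) (b 0 0) y d"
    by simp_all
  from approximates_mult [OF this 0(1)] show ?case
    by (intro exI [of _ "[Instr Mul (X 0 0) (Y 0 0)]"] exI [of _ "\<lambda>_ _. Reg (length is)"])
      (auto simp: mult_2)
next
  case (Suc k)
  define N where "N = m ^ k"
  define D where "D = 2 * m * m + R + 3"
  \<comment> \<open>The matrices \<open>f r\<close> and \<open>g r\<close>, of block size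
    \<open>N\<close>, are the factors of the \<open>r\<close>-th block product.\<close>
  define f where "f r i j A B = (\<Sum>t<m * m. u r t * a ((t div m) * N + i) ((t mod m) * N + j) A B)"
    for r i j A B
  define g where "g r i j A B = (\<Sum>t<m * m. v r t * b ((t div m) * N + i) ((t mod m) * N + j) A B)"
    for r i j A B
  \<comment> \<open>The exponent from the induction hypothesis, with \<open>d\<close> replaced by
    that of the linear combinations.\<close>
  define e where "e = 2 * (d + 1 + m * m) + D * k + 1"
  let ?z = "\<lambda>A B. M ^ (3 * k) * (M * x A B * (M * y A B))"
  let ?\<Phi> = "\<lambda>r is Z. \<forall>i<N. \<forall>j<N.
    approximates n is (Z i j) (\<lambda>A B. \<Sum>l<N. f r i l A B * g r l j A B) ?z e"
  have xy: "max 0 (x A B) = x A B" "max 0 (y A B) = y A B" for A B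
    using Suc.prems(2,3) by (simp_all add: max_def)
  have index: "(t div m) * N + i < m ^ Suc k" "(t mod m) * N + i < m ^ Suc k"
    if "t < m * m" "i < N" for t i
  proof -
    have "t div m < m" "t mod m < m"
      using that by (auto simp: less_mult_imp_div_less intro!: mod_less_divisor gr0I)
    then show "(t div m) * N + i < m ^ Suc k" "(t mod m) * N + i < m ^ Suc k"
      using that mult_add_less [of _ m i N] by (auto simp: N_def)
  qed
  \<comment> \<open>One block product: both factors are formed first and then multiplied
    recursively.\<close>
  have step: "\<exists>js Z. wf_prefix n ((is @ ks) @ js) \<and>
      length js \<le> 2 * (N * N * (2 * (m * m))) + rec_cost m R k \<and> ?\<Phi> r ((is @ ks) @ js) Z"
    if r: "r < R" and ks: "wf_prefix n (is @ ks)" for r ks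
  proof -
    let ?is1 = "is @ ks"
    have "\<exists>js Z. wf_prefix n (?is1 @ js) \<and> length js \<le> N * N * (2 * (m * m)) \<and>
      (\<forall>i<N. \<forall>j<N. approximates n (?is1 @ js) (Z i j)
        (\<lambda>A B. \<Sum>t<m * m. u r t * a ((t div m) * N + i) ((t mod m) * N + j) A B)
        (\<lambda>A B. M * max 0 (x A B)) (d + 1 + m * m))"
      by (rule approximates_linear_combination_matrix
          [where x = "\<lambda>i j t. X ((t div m) * N + i) ((t mod m) * N + j)"])
        (use ks u [OF r] index in \<open>auto intro!: approximates_append Suc.prems\<close>)
    then obtain js1 X' where js1: "wf_prefix n (?is1 @ js1)" "length js1 \<le> N * N * (2 * (m * m))"
      and X': "\<And>i j. i < N \<Longrightarrow> j < N \<Longrightarrow>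
        approximates n (?is1 @ js1) (X' i j) (f r i j) (\<lambda>A B. M * x A B) (d + 1 + m * m)"
      unfolding f_def xy by blast
    let ?is2 = "?is1 @ js1"
    have "\<exists>js Z. wf_prefix n (?is2 @ js) \<and> length js \<le> N * N * (2 * (m * m)) \<and>
      (\<forall>i<N. \<forall>j<N. approximates n (?is2 @ js) (Z i j)
        (\<lambda>A B. \<Sum>t<m * m. v r t * b ((t div m) * N + i) ((t mod m) * N + j) A B)
        (\<lambda>A B. M * max 0 (y A B)) (d + 1 + m * m))"
      by (rule approximates_linear_combination_matrix
          [where x = "\<lambda>i j t. Y ((t div m) * N + i) ((t mod m) * N + j)"])
        (use js1 v [OF r] index in \<open>auto intro!: approximates_append Suc.prems\<close>)
    then obtain js2 Y' where js2: "wf_prefix n (?is2 @ js2)" "length js2 \<le> N * N * (2 * (m * m))"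
      and Y': "\<And>i j. i < N \<Longrightarrow> j < N \<Longrightarrow>
        approximates n (?is2 @ js2) (Y' i j) (g r i j) (\<lambda>A B. M * y A B) (d + 1 + m * m)"
      unfolding g_def xy by blast
    let ?is3 = "?is2 @ js2"
    have "\<exists>js Z. wf_prefix n (?is3 @ js) \<and> length js \<le> rec_cost m R k \<and>
      (\<forall>i<m ^ k. \<forall>j<m ^ k. approximates n (?is3 @ js) (Z i j)
        (\<lambda>A B. \<Sum>l<m ^ k. f r i l A B * g r l j A B) ?z
        (2 * (d + 1 + m * m) + (2 * m * m + R + 3) * k + 1))"
      using approximates_append [OF X', of _ _ js2] Y' js2 Suc.prems(2,3) \<open>M \<ge> 0\<close>
      by (intro Suc.IH [where X = X' and Y = Y']) (auto simp: N_def)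
    then obtain js3 Z where "wf_prefix n (?is3 @ js3)" "length js3 \<le> rec_cost m R k"
      "?\<Phi> r (?is3 @ js3) Z"
      unfolding e_def N_def D_def by blast
    then show ?thesis
      using js1 js2 by (intro exI [of _ "js1 @ js2 @ js3"] exI [of _ Z]) auto
  qed
  have "\<exists>js Z. wf_prefix n (is @ js) \<and>
      length js \<le> R * (2 * (N * N * (2 * (m * m))) + rec_cost m R k) \<and>
      (\<forall>r<R. ?\<Phi> r (is @ js) (Z r))"
    by (rule extend_family [OF Suc.prems(1) step]) (auto intro: approximates_append)
  then obtain js Z where js: "wf_prefix n (is @ js)"
      "length js \<le> R * (2 * (N * N * (2 * (m * m))) + rec_cost m R k)"
    and Z: "\<And>r. r < R \<Longrightarrow> ?\<Phi> r (is @ js) (Z r)"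
    by blast
  \<comment> \<open>Position \<open>i\<close> of the large matrix is position \<open>i mod N\<close>
    inside block \<open>i div N\<close>.\<close>
  have split: "i div N < m" "i mod N < N" if "i < m ^ Suc k" for i
    using that by (auto simp: less_mult_imp_div_less N_def intro!: mod_less_divisor gr0I)
  have "\<exists>ks C. wf_prefix n ((is @ js) @ ks) \<and> length ks \<le> m ^ Suc k * m ^ Suc k * (2 * R) \<and>
    (\<forall>i<m ^ Suc k. \<forall>j<m ^ Suc k. approximates n ((is @ js) @ ks) (C i j)
      (\<lambda>A B. \<Sum>r<R. w (i div N) (j div N) r *
         (\<Sum>l<N. f r (i mod N) l A B * g r l (j mod N) A B))
      (\<lambda>A B. M * max 0 (?z A B)) (e + 1 + R))"
    by (rule approximates_linear_combination_matrix
        [where x = "\<lambda>i j r. Z r (i mod N) (j mod N)"])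
      (use js Z w split in auto)
  then obtain ks C where ks: "wf_prefix n ((is @ js) @ ks)"
      "length ks \<le> m ^ Suc k * m ^ Suc k * (2 * R)"
    and C: "\<And>i j. i < m ^ Suc k \<Longrightarrow> j < m ^ Suc k \<Longrightarrow> approximates n ((is @ js) @ ks) (C i j)
      (\<lambda>A B. \<Sum>r<R. w (i div N) (j div N) r *
         (\<Sum>l<N. f r (i mod N) l A B * g r l (j mod N) A B))
      (\<lambda>A B. M * max 0 (?z A B)) (e + 1 + R)"
    by blast
  have "approximates n ((is @ js) @ ks) (C i j)
      (\<lambda>A B. \<Sum>l<m ^ Suc k. a i l A B * b l j A B)
      (\<lambda>A B. M ^ (3 * Suc k) * (x A B * y A B)) (2 * d + D * Suc k + 1)"
    if ij: "i < m ^ Suc k" "j < m ^ Suc k" for i j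
  proof (rule approximates_cong [OF approximates_mono [OF C [OF ij]]])
    \<comment> \<open>Both sides agree: the factors contribute \<open>2 * (1 + m * m)\<close>, the
      recombination contributes \<open>1 + R\<close>, and together these are
      \<open>D\<close>.\<close>
    show "e + 1 + R \<le> 2 * d + D * Suc k + 1"
      by (simp add: e_def D_def)
  next
    fix A B
    have "0 \<le> ?z A B"
      using Suc.prems(2,3) \<open>M \<ge> 0\<close> by simp
    then show "M * max 0 (?z A B) \<le> M ^ (3 * Suc k) * (x A B * y A B)"
      by (simp add: max_def power_add eval_nat_numeral algebra_simps)
    show "(\<Sum>r<R. w (i div N) (j div N) r *
         (\<Sum>l<N. f r (i mod N) l A B * g r l (j mod N) A B)) =
        (\<Sum>l<m ^ Suc k. a i l A B * b l j A B)"
      using bilinear_mm_blocks [OF bil split(1) [OF ij(1)] split(1) [OF ij(2)], where N = N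
          and p = "i mod N" and q = "j mod N" and a = "\<lambda>i j. a i j A B" and b = "\<lambda>i j. b i j A B"]
      by (simp add: f_def g_def div_mult_mod_eq flip: N_def)
  qed
  then show ?case
    using js ks by (intro exI [of _ "js @ ks"] exI [of _ C]) (auto simp: N_def D_def)
qed


section \<open>The max norm and programs for arbitrary dimension\<close>

lemma finite_elements_mat: "finite (elements_mat A)"
  by (simp add: elements_mat_def)

lemma max_norm_nonneg: "max_norm A \<ge> 0"
  by (simp add: max_norm_def finite_elements_mat)

lemma norm_le_max_norm:
  "A \<in> carrier_mat r c \<Longrightarrow> i < r \<Longrightarrow> j < c \<Longrightarrow> norm (A $$ (i, j)) \<le> max_norm A"
  unfolding max_norm_def by (rule Max_ge) (auto simp: finite_elements_mat)

lemma max_norm_le: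
  assumes "0 \<le> b" "\<And>i j. i < dim_row A \<Longrightarrow> j < dim_col A \<Longrightarrow> norm (A $$ (i, j)) \<le> b"
  shows "max_norm A \<le> b"
  using assms unfolding max_norm_def by (subst Max_le_iff) (auto simp: finite_elements_mat)

lemma index_mult_mat_sum:
  assumes "A \<in> carrier_mat n n" "B \<in> carrier_mat n n" "i < n" "j < n"
  shows "(A * B) $$ (i, j) = (\<Sum>l<n. A $$ (i, l) * B $$ (l, j))"
  using assms by (auto simp: scalar_prod_def lessThan_atLeast0 intro!: sum.cong)

text \<open>The inputs are padded to size \<open>m ^ k\<close> with the operand
  \<open>Const 0\<close>, which costs no operation and has no error. The product is then the upper
  left corner.\<close>

lemma slp_of_bilinear_mm:
  fixes u :: "nat \<Rightarrow> nat \<Rightarrow> 'a::real_normed_field"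
  assumes bil: "bilinear_mm m R u v w" and "M \<ge> 0"
    and "\<And>r. r < R \<Longrightarrow> (\<Sum>t<m * m. norm (u r t)) \<le> M"
    and "\<And>r. r < R \<Longrightarrow> (\<Sum>t<m * m. norm (v r t)) \<le> M"
    and "\<And>i j. i < m \<Longrightarrow> j < m \<Longrightarrow> (\<Sum>r<R. norm (w i j r)) \<le> M"
    and "n \<le> m ^ k"
  shows "\<exists>P :: 'a slp. wf_slp n P \<and> op_count P \<le> rec_cost m R k \<and>
    (\<forall>\<epsilon> \<theta>. \<forall>A \<in> carrier_mat n n. \<forall>B \<in> carrier_mat n n.
      \<epsilon> \<ge> 0 \<longrightarrow> (\<forall>k. norm (\<theta> k) \<le> \<epsilon>) \<longrightarrow> (\<forall>i<n. \<forall>j<n.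
        appr \<epsilon> (rounded_output \<theta> n P A B $$ (i, j)) ((A * B) $$ (i, j))
          (M ^ (3 * k) * (max_norm A * max_norm B)) ((2 * m * m + R + 3) * k + 1)))"
proof -
  define X where "X i j = (if i < n \<and> j < n then InA i j else Const (0::'a))" for i j
  define Y where "Y i j = (if i < n \<and> j < n then InB i j else Const (0::'a))" for i j
  define a where "a i j A B = (if i < n \<and> j < n then A $$ (i, j) else (0::'a))" for i j and A B :: "'a mat"
  define b where "b i j A B = (if i < n \<and> j < n then B $$ (i, j) else (0::'a))" for i j and A B :: "'a mat"
  have "approximates n [] (X i j) (a i j) (\<lambda>A B. max_norm A) 0"
    "approximates n [] (Y i j) (b i j) (\<lambda>A B. max_norm B) 0" for i j
    by (auto simp: approximates_def X_def Y_def a_def b_def max_norm_nonneg norm_le_max_norm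
        intro!: appr_refl)
  with approximates_matrix_product [OF assms(1-5) wf_prefix_Nil, of "\<lambda>A B. max_norm A"
      "\<lambda>A B. max_norm B" k n X a 0 Y b]
  have "\<exists>js Z. wf_prefix n js \<and> length js \<le> rec_cost m R k \<and>
    (\<forall>i<m ^ k. \<forall>j<m ^ k. approximates n js (Z i j)
      (\<lambda>A B. \<Sum>l<m ^ k. a i l A B * b l j A B)
      (\<lambda>A B. M ^ (3 * k) * (max_norm A * max_norm B)) ((2 * m * m + R + 3) * k + 1))"
    by (simp add: max_norm_nonneg)
  then obtain js Z where js: "wf_prefix n js" "length js \<le> rec_cost m R k"
    and Z: "\<And>i j. i < m ^ k \<Longrightarrow> j < m ^ k \<Longrightarrow> approximates n js (Z i j)
      (\<lambda>A B. \<Sum>l<m ^ k. a i l A B * b l j A B)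
      (\<lambda>A B. M ^ (3 * k) * (max_norm A * max_norm B)) ((2 * m * m + R + 3) * k + 1)"
    by blast
  have "(\<Sum>l<m ^ k. a i l A B * b l j A B) = (A * B) $$ (i, j)"
    if "A \<in> carrier_mat n n" "B \<in> carrier_mat n n" "i < n" "j < n" for A B i j
    unfolding index_mult_mat_sum [OF that]
    by (rule sum.mono_neutral_cong_right) (use that assms(6) in \<open>auto simp: a_def b_def\<close>)
  then have Z: "approximates n js (Z i j) (\<lambda>A B. (A * B) $$ (i, j))
      (\<lambda>A B. M ^ (3 * k) * (max_norm A * max_norm B)) ((2 * m * m + R + 3) * k + 1)"
    if "i < n" "j < n" for i j
    using that assms(6) by (intro approximates_cong [OF Z]) auto
  show ?thesis
    using js Z
    by (intro exI [of _ "SLP js Z"])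
      (auto simp: wf_slp_def op_count_def rounded_output_def wf_prefix_def approximates_def rval_def)
qed

section \<open>Cost, second-order remainder and recursion depth\<close>

text \<open>The recursion gives \<open>R * rec_cost m R k\<close> plus
  \<open>6 * R * m * m * m ^ (2 * k)\<close>. Since \<open>R\<close> is at most
  \<open>Q / 2\<close>, each of the two terms is at most half of the claimed bound.\<close>

lemma rec_cost_le:
  assumes "real m * real m \<le> Q" "2 * real R \<le> Q"
  shows "real (rec_cost m R k) \<le> (6 * real m * real m + 1) * Q ^ k"
proof (induction k)
  case (Suc k)
  let ?K = "6 * real m * real m + 1"
  have Q: "0 \<le> Q"
    using assms(2) by simp
  have "real (m ^ k * m ^ k) = (real m * real m) ^ k"
    by (simp add: power_mult_distrib)
  also have "\<dots> \<le> Q ^ k"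
    using assms(1) by (intro power_mono) auto
  finally have mk: "real (m ^ k * m ^ k) \<le> Q ^ k" .
  have "real (rec_cost m R (Suc k)) =
      real R * real (rec_cost m R k) + (real R * (6 * real m * real m)) * real (m ^ k * m ^ k)"
    by (simp add: algebra_simps)
  also have "\<dots> \<le> Q / 2 * (?K * Q ^ k) + (Q / 2 * (6 * real m * real m)) * Q ^ k"
    using Suc mk assms Q by (intro add_mono mult_mono) auto
  also have "\<dots> \<le> ?K * Q ^ Suc k"
    using Q by (simp add: algebra_simps)
  finally show ?case .
qed auto

text \<open>The coefficient \<open>4 ^ e\<close> is crude but closes the induction:
  \<open>e + 4 ^ e + 4 ^ e * x\<close> is at most \<open>3 * 4 ^ e\<close>.\<close>

lemma power_one_plus_le:
  fixes x :: real
  assumes "0 \<le> x" "x \<le> 1"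
  shows "(1 + x) ^ e \<le> 1 + real e * x + 4 ^ e * x\<^sup>2"
proof (induction e)
  case (Suc e)
  have e: "real e \<le> 4 ^ e"
    using of_nat_less_two_power [of e, where 'a = real] power_mono [of 2 "4::real" e] by linarith
  have "(1 + x) ^ Suc e \<le> (1 + x) * (1 + real e * x + 4 ^ e * x\<^sup>2)"
    using Suc assms by (simp add: mult_left_mono)
  also have "\<dots> = 1 + real (Suc e) * x + (real e + 4 ^ e + 4 ^ e * x) * x\<^sup>2"
    by (simp add: algebra_simps power2_eq_square)
  also have "\<dots> \<le> 1 + real (Suc e) * x + 4 ^ Suc e * x\<^sup>2"
  proof -
    have "4 ^ e * x \<le> 4 ^ e * 1"
      using assms by (intro mult_left_mono) auto
    then have "real e + 4 ^ e + 4 ^ e * x \<le> 4 ^ Suc e"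
      unfolding power_Suc using e by linarith
    then show ?thesis
      by (intro add_left_mono mult_right_mono) auto
  qed
  finally show ?case .
qed auto

text \<open>Bernoulli's inequality shows that the remainder after the linear term is nonnegative,
  and \<open>power_one_plus_le\<close> bounds it from above.\<close>

lemma power_remainder_bigo:
  "(\<lambda>\<epsilon>::real. c * ((1 + \<epsilon>) ^ e - 1 - real e * \<epsilon>)) \<in> O[at_right 0](\<lambda>\<epsilon>. \<epsilon>\<^sup>2)"
proof (rule bigoI [where c = "\<bar>c\<bar> * 4 ^ e"])
  have "norm (c * ((1 + \<epsilon>) ^ e - 1 - real e * \<epsilon>)) \<le> \<bar>c\<bar> * 4 ^ e * norm (\<epsilon>\<^sup>2)"
    if "0 < \<epsilon>" "\<epsilon> < 1" for \<epsilon> :: real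
  proof -
    have "\<bar>(1 + \<epsilon>) ^ e - 1 - real e * \<epsilon>\<bar> \<le> 4 ^ e * \<epsilon>\<^sup>2"
      using power_one_plus_le [of \<epsilon> e] Bernoulli_inequality [of \<epsilon> e] that by auto
    then show ?thesis
      by (simp add: abs_mult mult_left_mono mult.assoc)
  qed
  then show "\<forall>\<^sub>F \<epsilon> in at_right 0. norm (c * ((1 + \<epsilon>) ^ e - 1 - real e * \<epsilon>)) \<le> \<bar>c\<bar> * 4 ^ e * norm (\<epsilon>\<^sup>2)"
    by (intro eventually_at_rightI [of 0 1]) auto
qed

text \<open>For the least such \<open>k\<close>, either \<open>k = 0\<close> or
  \<open>m ^ (k - 1) < n\<close>. The second bound fails for \<open>n = 0\<close>.\<close>

lemma exists_power_between:
  assumes "2 \<le> (m::nat)"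
  shows "\<exists>k. n \<le> m ^ k \<and> (0 < n \<longrightarrow> m ^ k \<le> m * n)"
proof -
  have ex: "n \<le> m ^ n"
    using assms less_exp [of n] power_mono [of 2 m n] by linarith
  define k where "k = (LEAST k. n \<le> m ^ k)"
  have k: "n \<le> m ^ k"
    unfolding k_def by (rule LeastI [of "\<lambda>k. n \<le> m ^ k", OF ex])
  moreover have "m ^ k \<le> m * n" if "0 < n"
  proof (cases k)
    case 0
    then show ?thesis using that assms by simp
  next
    case (Suc l)
    then have "\<not> n \<le> m ^ l"
      using not_less_Least [of l "\<lambda>k. n \<le> m ^ k"] by (simp add: k_def)
    then show ?thesis
      using Suc by simp
  qed
  ultimately show ?thesis by blast
qed

text \<open>With \<open>k\<close> levels, where \<open>m ^ k\<close> lies between \<open>n\<close>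
  and \<open>m * n\<close>, a quantity of the form \<open>b ^ k\<close> with
  \<open>b \<ge> 1\<close> is at most a constant times \<open>n\<close> to the power
  \<open>log m b\<close>. This applies to the cost with \<open>b = m powr q\<close> and to the error
  bound with \<open>b = M ^ 3\<close>.\<close>

lemma stable_algorithm_of_bilinear_mm:
  fixes u :: "nat \<Rightarrow> nat \<Rightarrow> 'a::real_normed_field"
  assumes bil: "bilinear_mm m R u v w" and m: "2 \<le> m" and q: "2 \<le> q"
    and R: "2 * real R \<le> real m powr q"
  shows "\<exists>P :: nat \<Rightarrow> 'a slp. mm_algorithm P \<and> ops_bigo P q \<and> numerically_stable P"
proof -
  \<comment> \<open>A common bound for all coefficient sums; the summand 1 makes its logarithm
    nonnegative.\<close>
  define M where "M = 1 + (\<Sum>r<R. \<Sum>t<m * m. norm (u r t)) + (\<Sum>r<R. \<Sum>t<m * m. norm (v r t)) +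
    (\<Sum>i<m. \<Sum>j<m. \<Sum>r<R. norm (w i j r))"
  have M: "1 \<le> M" "0 \<le> M"
    by (auto simp: M_def intro!: add_nonneg_nonneg sum_nonneg)
  have Mu: "(\<Sum>t<m * m. norm (u r t)) \<le> M" if "r < R" for r
    using member_le_sum [of r "{..<R}" "\<lambda>r. \<Sum>t<m * m. norm (u r t)"] that
    unfolding M_def by (smt (verit) finite_lessThan lessThan_iff norm_ge_zero sum_nonneg)
  have Mv: "(\<Sum>t<m * m. norm (v r t)) \<le> M" if "r < R" for r
    using member_le_sum [of r "{..<R}" "\<lambda>r. \<Sum>t<m * m. norm (v r t)"] that
    unfolding M_def by (smt (verit) finite_lessThan lessThan_iff norm_ge_zero sum_nonneg)
  have Mw: "(\<Sum>r<R. norm (w i j r)) \<le> M" if "i < m" "j < m" for i j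
  proof -
    have "(\<Sum>r<R. norm (w i j r)) \<le> (\<Sum>j<m. \<Sum>r<R. norm (w i j r))"
      using that by (intro member_le_sum) (auto intro: sum_nonneg)
    also have "\<dots> \<le> (\<Sum>i<m. \<Sum>j<m. \<Sum>r<R. norm (w i j r))"
      using that by (intro member_le_sum [of i _ "\<lambda>i. \<Sum>j<m. \<Sum>r<R. norm (w i j r)"]) (auto intro!: sum_nonneg)
    also have "\<dots> \<le> M"
      unfolding M_def by (simp add: sum_nonneg)
    finally show ?thesis .
  qed
  define D where "D = 2 * m * m + R + 3"
  obtain \<kappa> where \<kappa>: "\<And>n. n \<le> m ^ \<kappa> n" "\<And>n. 0 < n \<Longrightarrow> m ^ \<kappa> n \<le> m * n"
    using exists_power_between [OF m] by metis
  obtain P :: "nat \<Rightarrow> 'a slp" where wf: "\<And>n. wf_slp n (P n)"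
    and cost: "\<And>n. op_count (P n) \<le> rec_cost m R (\<kappa> n)"
    and err: "\<And>n \<epsilon> \<theta> A B i j. A \<in> carrier_mat n n \<Longrightarrow> B \<in> carrier_mat n n \<Longrightarrow> \<epsilon> \<ge> 0 \<Longrightarrow>
      (\<forall>k. norm (\<theta> k) \<le> \<epsilon>) \<Longrightarrow> i < n \<Longrightarrow> j < n \<Longrightarrow>
      appr \<epsilon> (rounded_output \<theta> n (P n) A B $$ (i, j)) ((A * B) $$ (i, j))
          (M ^ (3 * \<kappa> n) * (max_norm A * max_norm B)) (D * \<kappa> n + 1)"
    using slp_of_bilinear_mm [OF bil M(2) Mu Mv Mw \<kappa>(1)] unfolding D_def by metis
  have real_\<kappa>: "real m ^ \<kappa> n \<le> real m * real n" if "0 < n" for n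
    using \<kappa>(2) [OF that] by (metis of_nat_le_iff of_nat_mult of_nat_power)
  have "mm_algorithm P"
    unfolding mm_algorithm_def
  proof (intro allI conjI ballI)
    fix n and A B :: "'a mat"
    assume AB: "A \<in> carrier_mat n n" "B \<in> carrier_mat n n"
    show "exact_output n (P n) A B = A * B"
    proof (rule eq_matI)
      fix i j assume "i < dim_row (A * B)" "j < dim_col (A * B)"
      \<comment> \<open>For \<epsilon> = 0 the error bound vanishes, so the exact output is
        correct.\<close>
      then show "exact_output n (P n) A B $$ (i, j) = (A * B) $$ (i, j)"
        using err [OF AB, of 0 "\<lambda>_. 0" i j] AB by (simp add: exact_output_def appr_def)
    qed (use AB in \<open>auto simp: exact_output_def rounded_output_def\<close>)
  qed (rule wf)
  moreover have "ops_bigo P q"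
    unfolding ops_bigo_def
  proof (rule bigoI [where c = "(6 * real m * real m + 1) * real m powr q"])
    show "\<forall>\<^sub>F n in sequentially. norm (real (op_count (P n)))
      \<le> (6 * real m * real m + 1) * real m powr q * norm (real n powr q)"
      using eventually_gt_at_top [of 0]
    proof eventually_elim
      case (elim n)
      have "real m powr 2 \<le> real m powr q"
        using m q by (intro powr_mono) auto
      then have mm: "real m * real m \<le> real m powr q"
        using m by (simp add: power2_eq_square)
      have "(real m powr q) ^ \<kappa> n = (real m ^ \<kappa> n) powr q"
        using m by (simp add: powr_powr mult.commute flip: powr_realpow)
      also have "\<dots> \<le> (real m * real n) powr q"
        using m q real_\<kappa> [OF elim] by (intro powr_mono2) auto
      finally have pow: "(real m powr q) ^ \<kappa> n \<le> real m powr q * real n powr q"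
        by (simp add: powr_mult)
      have "real (op_count (P n)) \<le> real (rec_cost m R (\<kappa> n))"
        using cost by simp
      also have "\<dots> \<le> (6 * real m * real m + 1) * (real m powr q) ^ \<kappa> n"
        by (rule rec_cost_le [OF mm R])
      also have "\<dots> \<le> (6 * real m * real m + 1) * (real m powr q * real n powr q)"
        by (intro mult_left_mono pow) auto
      finally show ?case
        by (simp add: mult.assoc)
    qed
  qed
  moreover have "numerically_stable P"
    unfolding numerically_stable_def
  proof (intro exI conjI allI ballI)
    let ?\<mu> = "\<lambda>n. M ^ (3 * \<kappa> n) * real (D * \<kappa> n + 1)"
    \<comment> \<open>This exponent turns \<open>M ^ (3 * \<kappa> n)\<close> into
      \<open>(m ^ \<kappa> n) powr ?c\<close>. The additional 1 in the claimed exponent pays for the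
      factor \<open>D * \<kappa> n + 1\<close>.\<close>
    let ?c = "log (real m) (M ^ 3)"
    show "?\<mu> \<in> O(\<lambda>n. real n powr (?c + 1))"
    proof (rule bigoI [where c = "real m powr ?c * ((real D + 1) * real m)"])
      show "\<forall>\<^sub>F n in sequentially. norm (?\<mu> n)
        \<le> real m powr ?c * ((real D + 1) * real m) * norm (real n powr (?c + 1))"
        using eventually_gt_at_top [of 0]
      proof eventually_elim
        case (elim n)
        have c0: "0 \<le> ?c"
          using m M by simp
        have "M ^ (3 * \<kappa> n) = (real m powr ?c) ^ \<kappa> n"
          using m M by (simp add: power_mult)
        also have "\<dots> = (real m ^ \<kappa> n) powr ?c"
          using m by (simp add: powr_powr mult.commute flip: powr_realpow)
        also have "\<dots> \<le> (real m * real n) powr ?c"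
          using m c0 real_\<kappa> [OF elim] by (intro powr_mono2) auto
        finally have 1: "M ^ (3 * \<kappa> n) \<le> real m powr ?c * real n powr ?c"
          by (simp add: powr_mult)
        have "\<kappa> n < 2 ^ \<kappa> n" "(2::nat) ^ \<kappa> n \<le> m ^ \<kappa> n"
          using m by (auto intro: power_mono)
        then have "\<kappa> n \<le> m * n"
          using \<kappa>(2) [OF elim] by linarith
        moreover have "1 \<le> m * n"
          using m elim by simp
        ultimately have "D * \<kappa> n + 1 \<le> D * (m * n) + m * n"
          by (intro add_mono mult_left_mono) auto
        then have "real (D * \<kappa> n + 1) \<le> real (D * (m * n) + m * n)"
          by (rule of_nat_mono)
        then have 2: "real (D * \<kappa> n + 1) \<le> (real D + 1) * real m * real n"
          by (simp add: algebra_simps)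
        have "?\<mu> n \<le> real m powr ?c * real n powr ?c * ((real D + 1) * real m * real n)"
          by (rule mult_mono [OF 1 2]) auto
        then show ?case
          using elim M by (simp add: powr_add abs_mult mult_ac)
      qed
    qed
    fix n and A B :: "'a mat"
    assume AB: "A \<in> carrier_mat n n" "B \<in> carrier_mat n n"
    let ?x = "M ^ (3 * \<kappa> n) * (max_norm A * max_norm B)" and ?e = "D * \<kappa> n + 1"
    \<comment> \<open>Separates the part linear in \<epsilon> from the remainder.\<close>
    have expand: "y * (a * b) * (p - 1) = y * d * \<epsilon> * a * b + y * (a * b) * (p - 1 - d * \<epsilon>)"
      for y a b p d \<epsilon> :: real
      by (simp add: algebra_simps)
    show "\<exists>R \<in> O[at_right 0](\<lambda>\<epsilon>::real. \<epsilon>\<^sup>2).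
         \<forall>\<epsilon>>0. \<forall>\<theta> :: nat \<Rightarrow> 'a. (\<forall>k. norm (\<theta> k) \<le> \<epsilon>) \<longrightarrow>
           max_norm (rounded_output \<theta> n (P n) A B - A * B)
             \<le> ?\<mu> n * \<epsilon> * max_norm A * max_norm B + R \<epsilon>"
    \<comment> \<open>The remainder depends on \<open>A\<close>, \<open>B\<close> and
      \<open>n\<close>, but not on \<theta>, as required for uniformity.\<close>
    proof (intro bexI [OF _ power_remainder_bigo [of ?x ?e]] allI impI)
      fix \<epsilon> :: real and \<theta> :: "nat \<Rightarrow> 'a"
      assume \<epsilon>: "0 < \<epsilon>" "\<forall>k. norm (\<theta> k) \<le> \<epsilon>"
      have "max_norm (rounded_output \<theta> n (P n) A B - A * B) \<le> ?x * ((1 + \<epsilon>) ^ ?e - 1)"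
      proof (rule max_norm_le)
        have "1 \<le> (1 + \<epsilon>) ^ ?e"
          using \<epsilon> by (intro one_le_power) auto
        then show "0 \<le> ?x * ((1 + \<epsilon>) ^ ?e - 1)"
          using M by (intro mult_nonneg_nonneg) (auto simp: max_norm_nonneg)
      qed (use err [OF AB _ \<epsilon>(2)] \<epsilon>(1) AB in \<open>auto simp: appr_def\<close>)
      also have "\<dots> = ?\<mu> n * \<epsilon> * max_norm A * max_norm B + ?x * ((1 + \<epsilon>) ^ ?e - 1 - real ?e * \<epsilon>)"
        by (rule expand)
      finally show "max_norm (rounded_output \<theta> n (P n) A B - A * B)
        \<le> ?\<mu> n * \<epsilon> * max_norm A * max_norm B + ?x * ((1 + \<epsilon>) ^ ?e - 1 - real ?e * \<epsilon>)" .
    qed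
  qed
  ultimately show ?thesis by blast
qed


section \<open>Extracting a bilinear algorithm from a straight-line program\<close>

definition linear_form :: "nat \<Rightarrow> (nat \<Rightarrow> 'a::comm_ring_1) \<Rightarrow> 'a mat \<Rightarrow> 'a" where
  "linear_form n \<alpha> A = (\<Sum>t<n * n. \<alpha> t * A $$ (t div n, t mod n))"

text \<open>The Taylor expansion of \<open>F (\<sigma> \<cdot> A) (\<tau> \<cdot> B)\<close> modulo \<open>\<sigma>\<^sup>2\<close> and \<open>\<tau>\<^sup>2\<close> is
  \<open>c + \<sigma> a + \<tau> b + \<sigma> \<tau> g\<close>; here \<open>\<phi> \<tau>\<close> is the coefficient of \<open>\<sigma>\<close>.\<close>

definition mixed_jet ::
  "('a::real_normed_field mat \<Rightarrow> 'a mat \<Rightarrow> 'a) \<Rightarrow> 'a mat \<Rightarrow> 'a mat \<Rightarrow> 'a \<Rightarrow> 'a \<Rightarrow> 'a \<Rightarrow> 'a \<Rightarrow> bool" where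
  "mixed_jet F A B c a b g \<longleftrightarrow> (\<exists>\<phi>.
     (\<forall>\<tau>. ((\<lambda>\<sigma>. F (\<sigma> \<cdot>\<^sub>m A) (\<tau> \<cdot>\<^sub>m B)) has_field_derivative \<phi> \<tau>) (at 0)) \<and>
     F (0 \<cdot>\<^sub>m A) (0 \<cdot>\<^sub>m B) = c \<and> \<phi> 0 = a \<and>
     ((\<lambda>\<tau>. F (0 \<cdot>\<^sub>m A) (\<tau> \<cdot>\<^sub>m B)) has_field_derivative b) (at 0) \<and>
     (\<phi> has_field_derivative g) (at 0))"

text \<open>The products of \<open>p r\<close> and \<open>s r\<close> are to be shared by all values
  of a program; only \<open>c\<close>, \<alpha>, \<beta> and \<open>w\<close> belong to
  \<open>F\<close>, and they do not depend on \<open>A\<close> and \<open>B\<close>.\<close>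

definition bilinear_jet ::
  "nat \<Rightarrow> nat \<Rightarrow> (nat \<Rightarrow> nat \<Rightarrow> 'a::real_normed_field) \<Rightarrow> (nat \<Rightarrow> nat \<Rightarrow> 'a) \<Rightarrow> ('a mat \<Rightarrow> 'a mat \<Rightarrow> 'a) \<Rightarrow> bool" where
  "bilinear_jet n q p s F \<longleftrightarrow> (\<exists>c \<alpha> \<beta> w. \<forall>A \<in> carrier_mat n n. \<forall>B \<in> carrier_mat n n.
     mixed_jet F A B c (linear_form n \<alpha> A) (linear_form n \<beta> B)
       (\<Sum>r<q. w r * (linear_form n (p r) A * linear_form n (s r) B)))"

lemma linear_form_zero: "linear_form n (\<lambda>_. 0) A = 0"
  by (simp add: linear_form_def)

lemma linear_form_unit:
  assumes "i < n" "j < n"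
  shows "linear_form n (\<lambda>t. if t = i * n + j then 1 else 0) A = A $$ (i, j)"
proof -
  have "linear_form n (\<lambda>t. if t = i * n + j then 1 else 0) A =
      (\<Sum>t<n * n. if t = i * n + j then A $$ (t div n, t mod n) else 0)"
    unfolding linear_form_def by (intro sum.cong) auto
  then show ?thesis
    using assms mult_add_less [OF assms] by simp
qed

lemma linear_form_combine:
  "linear_form n (\<lambda>t. c * \<alpha> t + d * \<beta> t) A = c * linear_form n \<alpha> A + d * linear_form n \<beta> A"
  by (simp add: linear_form_def sum.distrib sum_distrib_left algebra_simps)

lemma mixed_jet_const: "mixed_jet (\<lambda>A B. c) A B c 0 0 0"
  unfolding mixed_jet_def by (rule exI [of _ "\<lambda>_. 0"]) simp

lemma mixed_jet_InA:
  assumes "i < dim_row A" "j < dim_col A"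
  shows "mixed_jet (\<lambda>A B. A $$ (i, j)) A B 0 (A $$ (i, j)) 0 0"
  unfolding mixed_jet_def using assms
  by (intro exI [of _ "\<lambda>_. A $$ (i, j)"]) (auto intro!: derivative_eq_intros)

lemma mixed_jet_InB:
  assumes "i < dim_row B" "j < dim_col B"
  shows "mixed_jet (\<lambda>A B. B $$ (i, j)) A B 0 0 (B $$ (i, j)) 0"
  unfolding mixed_jet_def using assms
  by (intro exI [of _ "\<lambda>_. 0"]) (auto intro!: derivative_eq_intros)

text \<open>The factor \<open>d\<close> covers addition with \<open>d = 1\<close> and subtraction
  with \<open>d = -1\<close>.\<close>

lemma mixed_jet_linear:
  assumes "mixed_jet F A B c a b g" "mixed_jet G A B c' a' b' g'"
  shows "mixed_jet (\<lambda>A B. F A B + d * G A B) A B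
    (c + d * c') (a + d * a') (b + d * b') (g + d * g')"
proof -
  obtain \<phi> where \<phi>:
    "\<And>\<tau>. ((\<lambda>\<sigma>. F (\<sigma> \<cdot>\<^sub>m A) (\<tau> \<cdot>\<^sub>m B)) has_field_derivative \<phi> \<tau>) (at 0)"
    "F (0 \<cdot>\<^sub>m A) (0 \<cdot>\<^sub>m B) = c" "\<phi> 0 = a"
    "((\<lambda>\<tau>. F (0 \<cdot>\<^sub>m A) (\<tau> \<cdot>\<^sub>m B)) has_field_derivative b) (at 0)"
    "(\<phi> has_field_derivative g) (at 0)"
    using assms(1) unfolding mixed_jet_def by blast
  obtain \<psi> where \<psi>:
    "\<And>\<tau>. ((\<lambda>\<sigma>. G (\<sigma> \<cdot>\<^sub>m A) (\<tau> \<cdot>\<^sub>m B)) has_field_derivative \<psi> \<tau>) (at 0)"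
    "G (0 \<cdot>\<^sub>m A) (0 \<cdot>\<^sub>m B) = c'" "\<psi> 0 = a'"
    "((\<lambda>\<tau>. G (0 \<cdot>\<^sub>m A) (\<tau> \<cdot>\<^sub>m B)) has_field_derivative b') (at 0)"
    "(\<psi> has_field_derivative g') (at 0)"
    using assms(2) unfolding mixed_jet_def by blast
  show ?thesis
    unfolding mixed_jet_def
    by (intro exI [of _ "\<lambda>\<tau>. \<phi> \<tau> + d * \<psi> \<tau>"] conjI allI DERIV_add DERIV_cmult \<phi>(1,4,5) \<psi>(1,4,5))
      (simp_all add: \<phi>(2,3) \<psi>(2,3))
qed

text \<open>Multiplication of two truncated Taylor expansions. In the mixed coefficient only
  \<open>a * b'\<close> and \<open>a' * b\<close> are new products of linear parts.\<close>

lemma mixed_jet_mult: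
  assumes "mixed_jet F A B c a b g" "mixed_jet G A B c' a' b' g'"
  shows "mixed_jet (\<lambda>A B. F A B * G A B) A B
    (c * c') (c' * a + c * a') (c' * b + c * b') (c' * g + c * g' + a * b' + a' * b)"
proof -
  obtain \<phi> where \<phi>:
    "\<And>\<tau>. ((\<lambda>\<sigma>. F (\<sigma> \<cdot>\<^sub>m A) (\<tau> \<cdot>\<^sub>m B)) has_field_derivative \<phi> \<tau>) (at 0)"
    "F (0 \<cdot>\<^sub>m A) (0 \<cdot>\<^sub>m B) = c" "\<phi> 0 = a"
    "((\<lambda>\<tau>. F (0 \<cdot>\<^sub>m A) (\<tau> \<cdot>\<^sub>m B)) has_field_derivative b) (at 0)"
    "(\<phi> has_field_derivative g) (at 0)"
    using assms(1) unfolding mixed_jet_def by blast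
  obtain \<psi> where \<psi>:
    "\<And>\<tau>. ((\<lambda>\<sigma>. G (\<sigma> \<cdot>\<^sub>m A) (\<tau> \<cdot>\<^sub>m B)) has_field_derivative \<psi> \<tau>) (at 0)"
    "G (0 \<cdot>\<^sub>m A) (0 \<cdot>\<^sub>m B) = c'" "\<psi> 0 = a'"
    "((\<lambda>\<tau>. G (0 \<cdot>\<^sub>m A) (\<tau> \<cdot>\<^sub>m B)) has_field_derivative b') (at 0)"
    "(\<psi> has_field_derivative g') (at 0)"
    using assms(2) unfolding mixed_jet_def by blast
  \<comment> \<open>The derivative of the product in \<sigma> at 0, as a function of \<tau>.\<close>
  let ?\<chi> = "\<lambda>\<tau>. \<phi> \<tau> * G (0 \<cdot>\<^sub>m A) (\<tau> \<cdot>\<^sub>m B) + \<psi> \<tau> * F (0 \<cdot>\<^sub>m A) (\<tau> \<cdot>\<^sub>m B)"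
  have "((\<lambda>\<sigma>. F (\<sigma> \<cdot>\<^sub>m A) (\<tau> \<cdot>\<^sub>m B) * G (\<sigma> \<cdot>\<^sub>m A) (\<tau> \<cdot>\<^sub>m B)) has_field_derivative ?\<chi> \<tau>) (at 0)" for \<tau>
    by (rule DERIV_mult [OF \<phi>(1) \<psi>(1)])
  moreover have "((\<lambda>\<tau>. F (0 \<cdot>\<^sub>m A) (\<tau> \<cdot>\<^sub>m B) * G (0 \<cdot>\<^sub>m A) (\<tau> \<cdot>\<^sub>m B)) has_field_derivative
      c' * b + c * b') (at 0)"
    using DERIV_mult [OF \<phi>(4) \<psi>(4)] by (simp add: \<phi>(2) \<psi>(2) mult.commute)
  moreover have "(?\<chi> has_field_derivative c' * g + c * g' + a * b' + a' * b) (at 0)"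
    using DERIV_add [OF DERIV_mult [OF \<phi>(5) \<psi>(4)] DERIV_mult [OF \<psi>(5) \<phi>(4)]]
    by (simp add: \<phi>(2,3) \<psi>(2,3) algebra_simps)
  ultimately show ?thesis
    unfolding mixed_jet_def
    by (intro exI [of _ ?\<chi>]) (simp add: \<phi>(2,3) \<psi>(2,3) mult.commute)
qed

text \<open>Separate equations for \<open>a\<close>, \<open>b\<close> and \<open>g\<close> allow a
  jet from the calculus rules to be used first and rewritten into linear forms afterwards.\<close>

lemma bilinear_jetI:
  fixes F :: "'a::real_normed_field mat \<Rightarrow> 'a mat \<Rightarrow> 'a"
  assumes "\<And>A B. A \<in> carrier_mat n n \<Longrightarrow> B \<in> carrier_mat n n \<Longrightarrow> \<exists>a b g. mixed_jet F A B c a b g \<and>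
     a = linear_form n \<alpha> A \<and> b = linear_form n \<beta> B \<and>
     g = (\<Sum>r<q. w r * (linear_form n (p r) A * linear_form n (s r) B))"
  shows "bilinear_jet n q p s F"
  unfolding bilinear_jet_def
proof (intro exI ballI)
  fix A B :: "'a mat" assume "A \<in> carrier_mat n n" "B \<in> carrier_mat n n"
  from assms [OF this] show "mixed_jet F A B c (linear_form n \<alpha> A) (linear_form n \<beta> B)
       (\<Sum>r<q. w r * (linear_form n (p r) A * linear_form n (s r) B))"
    by (elim exE conjE) (simp only:)
qed

lemma bilinear_jet_const: "bilinear_jet n q p s (\<lambda>A B. c)"
  by (rule bilinear_jetI [where c = c and \<alpha> = "\<lambda>_. 0" and \<beta> = "\<lambda>_. 0" and w = "\<lambda>_. 0"])
    (auto simp: linear_form_zero mixed_jet_const)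

lemma bilinear_jet_InA:
  assumes "i < n" "j < n"
  shows "bilinear_jet n q p s (\<lambda>A B. A $$ (i, j))"
  using assms
  by (intro bilinear_jetI [where c = 0 and \<alpha> = "\<lambda>t. if t = i * n + j then 1 else 0"
        and \<beta> = "\<lambda>_. 0" and w = "\<lambda>_. 0"])
    (simp add: linear_form_zero linear_form_unit mixed_jet_InA)

lemma bilinear_jet_InB:
  assumes "i < n" "j < n"
  shows "bilinear_jet n q p s (\<lambda>A B. B $$ (i, j))"
  using assms
  by (intro bilinear_jetI [where c = 0 and \<beta> = "\<lambda>t. if t = i * n + j then 1 else 0"
        and \<alpha> = "\<lambda>_. 0" and w = "\<lambda>_. 0"])
    (simp add: linear_form_zero linear_form_unit mixed_jet_InB)

lemma bilinear_jet_extend: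
  assumes "bilinear_jet n q p s F" "q \<le> q'" "\<And>r. r < q \<Longrightarrow> p' r = p r" "\<And>r. r < q \<Longrightarrow> s' r = s r"
  shows "bilinear_jet n q' p' s' F"
proof -
  obtain c \<alpha> \<beta> w where F: "\<And>A B. A \<in> carrier_mat n n \<Longrightarrow> B \<in> carrier_mat n n \<Longrightarrow>
     mixed_jet F A B c (linear_form n \<alpha> A) (linear_form n \<beta> B)
       (\<Sum>r<q. w r * (linear_form n (p r) A * linear_form n (s r) B))"
    using assms(1) unfolding bilinear_jet_def by blast
  have eq: "(\<Sum>r<q'. (if r < q then w r else 0) * (linear_form n (p' r) A * linear_form n (s' r) B)) =
      (\<Sum>r<q. w r * (linear_form n (p r) A * linear_form n (s r) B))" for A B
    by (rule sum.mono_neutral_cong_right) (use assms(2-4) in auto)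
  show ?thesis
    by (intro bilinear_jetI [where w = "\<lambda>r. if r < q then w r else 0"] exI conjI, rule F)
      (simp_all only: eq)
qed

lemma bilinear_jet_linear:
  assumes "bilinear_jet n q p s F" "bilinear_jet n q p s G"
  shows "bilinear_jet n q p s (\<lambda>A B. F A B + d * G A B)"
proof -
  obtain c \<alpha> \<beta> w where F: "\<And>A B. A \<in> carrier_mat n n \<Longrightarrow> B \<in> carrier_mat n n \<Longrightarrow>
     mixed_jet F A B c (linear_form n \<alpha> A) (linear_form n \<beta> B)
       (\<Sum>r<q. w r * (linear_form n (p r) A * linear_form n (s r) B))"
    using assms(1) unfolding bilinear_jet_def by blast
  obtain c' \<alpha>' \<beta>' w' where G: "\<And>A B. A \<in> carrier_mat n n \<Longrightarrow> B \<in> carrier_mat n n \<Longrightarrow>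
     mixed_jet G A B c' (linear_form n \<alpha>' A) (linear_form n \<beta>' B)
       (\<Sum>r<q. w' r * (linear_form n (p r) A * linear_form n (s r) B))"
    using assms(2) unfolding bilinear_jet_def by blast
  show ?thesis
    by (intro bilinear_jetI [where \<alpha> = "\<lambda>t. \<alpha> t + d * \<alpha>' t" and \<beta> = "\<lambda>t. \<beta> t + d * \<beta>' t"
          and w = "\<lambda>r. w r + d * w' r"] exI conjI, rule mixed_jet_linear [OF F G])
      (simp_all only: linear_form_combine [where c = 1, simplified] distrib_right sum.distrib sum_distrib_left mult.assoc)
qed

text \<open>The terms \<open>c' * g + c * g'\<close> stay in the span of the old products. The other
  two, \<alpha> with \<beta>' and \<alpha>' with \<beta>, are appended at the indices
  \<open>q\<close> and \<open>Suc q\<close>.\<close>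

lemma bilinear_jet_mult:
  assumes "bilinear_jet n q p s F" "bilinear_jet n q p s G"
  shows "\<exists>p' s'. bilinear_jet n (q + 2) p' s' (\<lambda>A B. F A B * G A B) \<and>
    (\<forall>r<q. p' r = p r \<and> s' r = s r)"
proof -
  obtain c \<alpha> \<beta> w where F: "\<And>A B. A \<in> carrier_mat n n \<Longrightarrow> B \<in> carrier_mat n n \<Longrightarrow>
     mixed_jet F A B c (linear_form n \<alpha> A) (linear_form n \<beta> B)
       (\<Sum>r<q. w r * (linear_form n (p r) A * linear_form n (s r) B))"
    using assms(1) unfolding bilinear_jet_def by blast
  obtain c' \<alpha>' \<beta>' w' where G: "\<And>A B. A \<in> carrier_mat n n \<Longrightarrow> B \<in> carrier_mat n n \<Longrightarrow>
     mixed_jet G A B c' (linear_form n \<alpha>' A) (linear_form n \<beta>' B)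
       (\<Sum>r<q. w' r * (linear_form n (p r) A * linear_form n (s r) B))"
    using assms(2) unfolding bilinear_jet_def by blast
  define p' where "p' = p(q := \<alpha>, Suc q := \<alpha>')"
  define s' where "s' = s(q := \<beta>', Suc q := \<beta>)"
  define w'' where "w'' = (\<lambda>r. c' * w r + c * w' r)(q := 1, Suc q := 1)"
  have eq: "(\<Sum>r<q + 2. w'' r * (linear_form n (p' r) A * linear_form n (s' r) B)) =
      c' * (\<Sum>r<q. w r * (linear_form n (p r) A * linear_form n (s r) B)) +
      c * (\<Sum>r<q. w' r * (linear_form n (p r) A * linear_form n (s r) B)) +
      linear_form n \<alpha> A * linear_form n \<beta>' B + linear_form n \<alpha>' A * linear_form n \<beta> B" for A B
  proof -
    have "(\<Sum>r<q. w'' r * (linear_form n (p' r) A * linear_form n (s' r) B)) =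
      (\<Sum>r<q. c' * (w r * (linear_form n (p r) A * linear_form n (s r) B)) +
        c * (w' r * (linear_form n (p r) A * linear_form n (s r) B)))"
      by (intro sum.cong) (auto simp: w''_def p'_def s'_def algebra_simps)
    moreover have "w'' q = 1" "w'' (Suc q) = 1" "p' q = \<alpha>" "p' (Suc q) = \<alpha>'"
      "s' q = \<beta>'" "s' (Suc q) = \<beta>"
      by (simp_all add: w''_def p'_def s'_def)
    ultimately show ?thesis
      by (simp add: numeral_2_eq_2 sum.distrib flip: sum_distrib_left)
  qed
  have "bilinear_jet n (q + 2) p' s' (\<lambda>A B. F A B * G A B)"
    by (intro bilinear_jetI [where \<alpha> = "\<lambda>t. c' * \<alpha> t + c * \<alpha>' t"
          and \<beta> = "\<lambda>t. c' * \<beta> t + c * \<beta>' t" and w = w''] exI conjI, rule mixed_jet_mult [OF F G])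
      (simp_all only: linear_form_combine eq)
  then show ?thesis
    by (intro exI [of _ p'] exI [of _ s']) (simp add: p'_def s'_def)
qed

text \<open>Each instruction reserves two new products. The choice of \<open>p\<close> and
  \<open>s\<close> precedes that of the operand, so one list of products serves all
  registers.\<close>

lemma bilinear_jet_prefix:
  fixes "is" :: "'a::real_normed_field instr list"
  assumes "wf_prefix n is"
  shows "\<exists>p s. \<forall>x. wf_operand n (length is) x \<longrightarrow>
    bilinear_jet n (2 * length is) p s (\<lambda>A B. rval (\<lambda>_. 0) A B is x)"
  using assms
proof (induction "is" rule: rev_induct)
  case Nil
  have "bilinear_jet n 0 p s (\<lambda>A B. rval (\<lambda>_. 0) A B [] x)" if "wf_operand n 0 x"
    for p s and x :: "'a operand"
    using that by (cases x) (simp_all add: bilinear_jet_const bilinear_jet_InA bilinear_jet_InB)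
  then show ?case by simp
next
  case (snoc ins "is")
  obtain f x y where ins: "ins = Instr f x y"
    by (cases ins)
  with snoc.prems have wf: "wf_prefix n is" "wf_operand n (length is) x" "wf_operand n (length is) y"
    by (simp_all add: wf_prefix_snoc)
  let ?q = "2 * length is" and ?F = "\<lambda>x A B. rval (\<lambda>_. 0) A B is x"
  obtain p s where ps: "\<And>x. wf_operand n (length is) x \<Longrightarrow> bilinear_jet n ?q p s (?F x)"
    using snoc.IH [OF wf(1)] by blast
  obtain p' s' where ps': "\<And>r. r < ?q \<Longrightarrow> p' r = p r" "\<And>r. r < ?q \<Longrightarrow> s' r = s r"
    and new: "bilinear_jet n (?q + 2) p' s' (\<lambda>A B. apply_op f (?F x A B) (?F y A B))"
  proof (cases f)
    case Add
    have "bilinear_jet n (?q + 2) p s (\<lambda>A B. ?F x A B + 1 * ?F y A B)"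
      by (rule bilinear_jet_extend [OF bilinear_jet_linear [OF ps [OF wf(2)] ps [OF wf(3)]]]) auto
    then show thesis
      by (intro that [of p s]) (simp_all add: Add)
  next
    case Sub
    have "bilinear_jet n (?q + 2) p s (\<lambda>A B. ?F x A B + (-1) * ?F y A B)"
      by (rule bilinear_jet_extend [OF bilinear_jet_linear [OF ps [OF wf(2)] ps [OF wf(3)]]]) auto
    then show thesis
      by (intro that [of p s]) (simp_all add: Sub)
  next
    case Mul
    obtain p' s' where "bilinear_jet n (?q + 2) p' s' (\<lambda>A B. ?F x A B * ?F y A B)"
      "\<forall>r<?q. p' r = p r \<and> s' r = s r"
      using bilinear_jet_mult [OF ps [OF wf(2)] ps [OF wf(3)]] by blast
    then show thesis
      by (intro that [of p' s']) (simp_all add: Mul)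
  qed
  have "bilinear_jet n (?q + 2) p' s' (\<lambda>A B. rval (\<lambda>_. 0) A B (is @ [ins]) z)"
    if z: "wf_operand n (length (is @ [ins])) z" for z
  proof (cases "wf_operand n (length is) z")
    case True
    then show ?thesis
      using bilinear_jet_extend [OF ps [OF True], of "?q + 2" p' s'] ps' by (simp add: rval_append)
  next
    case False
    with z have "z = Reg (length is)"
      by (cases z) (auto simp: less_Suc_eq)
    then show ?thesis
      using new by (simp add: ins rval_snoc)
  qed
  then show ?case
    by (intro exI [of _ p'] exI [of _ s']) simp
qed

text \<open>The mixed derivative of an output at \<open>(\<sigma> A, \<tau> B)\<close> is the entry
  of \<open>A * B\<close> itself, and by \<open>bilinear_jet_prefix\<close> it is a combination of
  \<open>2 * op_count P\<close> products.\<close>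

lemma bilinear_mm_of_slp:
  fixes P :: "'a::real_normed_field slp"
  assumes wf: "wf_slp n P"
    and exact: "\<And>A B. A \<in> carrier_mat n n \<Longrightarrow> B \<in> carrier_mat n n \<Longrightarrow> exact_output n P A B = A * B"
  shows "\<exists>u v (w :: nat \<Rightarrow> nat \<Rightarrow> nat \<Rightarrow> 'a). bilinear_mm n (2 * op_count P) u v w"
proof -
  have "wf_prefix n (instrs P)" and out: "\<And>i j. i < n \<Longrightarrow> j < n \<Longrightarrow> wf_operand n (length (instrs P)) (outs P i j)"
    using wf by (auto simp: wf_slp_def wf_prefix_def)
  let ?q = "2 * op_count P" and ?F = "\<lambda>i j A B. rval (\<lambda>_. 0) A B (instrs P) (outs P i j)"
  obtain p s where ps: "\<And>i j. i < n \<Longrightarrow> j < n \<Longrightarrow> bilinear_jet n ?q p s (?F i j)"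
    using bilinear_jet_prefix [OF \<open>wf_prefix n (instrs P)\<close>] out unfolding op_count_def by blast
  let ?good = "\<lambda>i j w. \<forall>A \<in> carrier_mat n n. \<forall>B \<in> carrier_mat n n.
      (A * B) $$ (i, j) = (\<Sum>r<?q. w r * (linear_form n (p r) A * linear_form n (s r) B))"
  have ex: "\<exists>w. ?good i j w"
    if ij: "i < n" "j < n" for i j
  proof -
    obtain w where w: "\<And>A B. A \<in> carrier_mat n n \<Longrightarrow> B \<in> carrier_mat n n \<Longrightarrow> \<exists>\<phi>.
       (\<forall>\<tau>. ((\<lambda>\<sigma>. ?F i j (\<sigma> \<cdot>\<^sub>m A) (\<tau> \<cdot>\<^sub>m B)) has_field_derivative \<phi> \<tau>) (at 0)) \<and>
       (\<phi> has_field_derivative (\<Sum>r<?q. w r * (linear_form n (p r) A * linear_form n (s r) B))) (at 0)"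
      using ps [OF ij] unfolding bilinear_jet_def mixed_jet_def by blast
    have "(A * B) $$ (i, j) = (\<Sum>r<?q. w r * (linear_form n (p r) A * linear_form n (s r) B))"
      if AB: "A \<in> carrier_mat n n" "B \<in> carrier_mat n n" for A B
    proof -
      let ?z = "(A * B) $$ (i, j)"
      \<comment> \<open>Exactness on the scaled inputs determines the output as a function of
        \<sigma> and \<tau>; its derivatives are then compared with those of the jet.\<close>
      have F: "?F i j (\<sigma> \<cdot>\<^sub>m A) (\<tau> \<cdot>\<^sub>m B) = \<sigma> * (\<tau> * ?z)" for \<sigma> \<tau>
      proof -
        have "?F i j (\<sigma> \<cdot>\<^sub>m A) (\<tau> \<cdot>\<^sub>m B) = exact_output n P (\<sigma> \<cdot>\<^sub>m A) (\<tau> \<cdot>\<^sub>m B) $$ (i, j)"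
          using ij by (simp add: exact_output_def rounded_output_def rval_def)
        also have "\<dots> = ((\<sigma> \<cdot>\<^sub>m A) * (\<tau> \<cdot>\<^sub>m B)) $$ (i, j)"
          using AB by (subst exact) auto
        also have "\<dots> = \<sigma> * (\<tau> * ?z)"
          using AB ij by (subst (1 2) index_mult_mat_sum [of _ n])
            (auto simp: sum_distrib_left mult_ac intro!: sum.cong)
        finally show ?thesis .
      qed
      obtain \<phi> where \<phi>: "\<And>\<tau>. ((\<lambda>\<sigma>. \<sigma> * (\<tau> * ?z)) has_field_derivative \<phi> \<tau>) (at 0)"
        "(\<phi> has_field_derivative (\<Sum>r<?q. w r * (linear_form n (p r) A * linear_form n (s r) B))) (at 0)"
        using w [OF AB] unfolding F by blast
      have "\<phi> \<tau> = \<tau> * ?z" for \<tau>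
        by (rule DERIV_unique [OF \<phi>(1)]) (auto intro!: derivative_eq_intros)
      then have "\<phi> = (\<lambda>\<tau>. \<tau> * ?z)" by blast
      then have "(\<phi> has_field_derivative ?z) (at 0)"
        by (auto intro!: derivative_eq_intros)
      then show ?thesis
        using \<phi>(2) by (rule DERIV_unique)
    qed
    then show ?thesis by blast
  qed
  define w where "w i j = (SOME w. ?good i j w)" for i j
  have w: "?good i j (w i j)" if "i < n" "j < n" for i j
    unfolding w_def by (rule someI_ex [OF ex [OF that]])
  \<comment> \<open>Passes from matrices to the coefficient functions over which
    \<open>bilinear_mm\<close> quantifies.\<close>
  have form: "linear_form n \<alpha> (mat n n (\<lambda>(i, j). a i j)) = (\<Sum>t<n * n. \<alpha> t * a (t div n) (t mod n))"
    for \<alpha> and a :: "nat \<Rightarrow> nat \<Rightarrow> 'a"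
    unfolding linear_form_def
  proof (rule sum.cong [OF refl])
    fix t assume "t \<in> {..<n * n}"
    then have "t div n < n" "t mod n < n"
      by (auto simp: less_mult_imp_div_less intro!: mod_less_divisor gr0I)
    then show "\<alpha> t * mat n n (\<lambda>(i, j). a i j) $$ (t div n, t mod n) = \<alpha> t * a (t div n) (t mod n)"
      by simp
  qed
  have "(\<Sum>l<n. a i l * b l j) = (\<Sum>r<?q. w i j r *
      ((\<Sum>t<n * n. p r t * a (t div n) (t mod n)) * (\<Sum>t<n * n. s r t * b (t div n) (t mod n))))"
    if "i < n" "j < n" for a b :: "nat \<Rightarrow> nat \<Rightarrow> 'a" and i j
    using w [OF that, rule_format, of "mat n n (\<lambda>(i, j). a i j)" "mat n n (\<lambda>(i, j). b i j)"] that
    by (simp add: form index_mult_mat_sum [of _ n] del: index_mult_mat)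
  then show ?thesis
    unfolding bilinear_mm_def by (intro exI [of _ p] exI [of _ s] exI [of _ w] allI impI)
qed


section \<open>The exponent of matrix multiplication\<close>

lemma run_instrs_cong:
  assumes "\<And>ins x. ins \<in> set is \<Longrightarrow> x \<in> {arg1 ins, arg2 ins} \<Longrightarrow>
    (\<And>regs. operand_val A B regs x = operand_val A' B regs x)"
  shows "run_instrs \<theta> A B regs is = run_instrs \<theta> A' B regs is"
  using assms
proof (induction "is" arbitrary: regs)
  case (Cons ins "is")
  obtain f x y where ins: "ins = Instr f x y"
    by (cases ins)
  have "operand_val A B regs z = operand_val A' B regs z" if "z \<in> {x, y}" for z
    using Cons.prems [of ins z] that by (simp add: ins)
  moreover have "run_instrs \<theta> A B rs is = run_instrs \<theta> A' B rs is" for rs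
    using Cons.prems by (intro Cons.IH) auto
  ultimately show ?case
    by (simp add: ins)
qed simp

text \<open>An entry of \<open>A\<close> that no instruction reads cannot influence the product correctly.\<close>

lemma mm_slp_op_count_ge:
  fixes P :: "'a::comm_ring_1 slp"
  assumes wf: "wf_slp n P"
    and exact: "\<And>A B. A \<in> carrier_mat n n \<Longrightarrow> B \<in> carrier_mat n n \<Longrightarrow> exact_output n P A B = A * B"
  shows "n * n \<le> 2 * op_count P"
proof (rule ccontr)
  assume small: "\<not> n * n \<le> 2 * op_count P"
  \<comment> \<open>The operands that are read, at most two per instruction; so some
    \<open>InA i j\<close> is missing.\<close>
  define S where "S = arg1 ` set (instrs P) \<union> arg2 ` set (instrs P)"
  have "card S \<le> card (arg1 ` set (instrs P)) + card (arg2 ` set (instrs P))"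
    unfolding S_def by (rule card_Un_le)
  also have "\<dots> \<le> 2 * op_count P"
    using card_image_le [of "set (instrs P)" arg1] card_image_le [of "set (instrs P)" arg2]
      card_length [of "instrs P"] by (simp add: op_count_def)
  also have "\<dots> < card ((\<lambda>(i, j). InA i j :: 'a operand) ` ({..<n} \<times> {..<n}))"
    using small by (subst card_image) (auto simp: inj_on_def)
  finally have "\<not> (\<lambda>(i, j). InA i j) ` ({..<n} \<times> {..<n}) \<subseteq> S"
    using card_mono [of S] by (auto simp: S_def not_less [symmetric])
  then obtain i j where ij: "i < n" "j < n" "InA i j \<notin> S"
    by auto
  define A where "A = mat n n (\<lambda>p. if p = (i, j) then 1 else 0 :: 'a)"
  have carrier: "A \<in> carrier_mat n n"
    by (simp add: A_def)
  have same: "operand_val (0\<^sub>m n n) B regs x = operand_val A B regs x"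
    if "x \<noteq> InA i j" "wf_operand n k x" for B regs x k
    using that by (cases x) (auto simp: A_def)
  have run: "run_instrs (\<lambda>_. 0) (0\<^sub>m n n) B [] (instrs P) = run_instrs (\<lambda>_. 0) A B [] (instrs P)" for B
  proof (rule run_instrs_cong)
    fix ins x and regs :: "'a list"
    assume ins: "ins \<in> set (instrs P)" "x \<in> {arg1 ins, arg2 ins}"
    then obtain k where "wf_operand n k x"
      using wf by (auto simp: wf_slp_def in_set_conv_nth)
    moreover have "x \<noteq> InA i j"
      using ins ij(3) by (auto simp: S_def)
    ultimately show "operand_val (0\<^sub>m n n) B regs x = operand_val A B regs x"
      by (intro same)
  qed
  have out: "operand_val C B (run_instrs (\<lambda>_. 0) C B [] (instrs P)) (outs P i j) =
      (\<Sum>l<n. C $$ (i, l) * B $$ (l, j))"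
    if "C \<in> carrier_mat n n" "B \<in> carrier_mat n n" for C B
  proof -
    have "operand_val C B (run_instrs (\<lambda>_. 0) C B [] (instrs P)) (outs P i j) =
        exact_output n P C B $$ (i, j)"
      using ij by (simp add: exact_output_def rounded_output_def)
    then show ?thesis
      by (simp only: exact [OF that] index_mult_mat_sum [OF that ij(1,2)])
  qed
  show False
  proof (cases "outs P i j = InA i j")
    case True
    \<comment> \<open>The output is the input entry 1, although the product with
      \<open>B = 0\<close> vanishes.\<close>
    then show False
      using out [OF carrier zero_carrier_mat] ij by (simp add: A_def)
  next
    case False
    have "wf_operand n (length (instrs P)) (outs P i j)"
      using wf ij by (simp add: wf_slp_def)
    \<comment> \<open>With \<open>B\<close> the identity, the program cannot distinguish
      \<open>A\<close> from the zero matrix, but the entries of the two products differ.\<close>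
    then have "(\<Sum>l<n. 0\<^sub>m n n $$ (i, l) * 1\<^sub>m n $$ (l, j)) = (\<Sum>l<n. A $$ (i, l) * 1\<^sub>m n $$ (l, j))"
      unfolding out [OF carrier one_carrier_mat, symmetric]
        out [OF zero_carrier_mat one_carrier_mat, symmetric] run
      by (rule same [OF False])
    moreover have "(\<Sum>l<n. A $$ (i, l) * 1\<^sub>m n $$ (l, j)) = (\<Sum>l<n. if l = j then 1 else 0)"
      using ij by (intro sum.cong) (auto simp: A_def)
    ultimately show False
      using ij by simp
  qed
qed

text \<open>Used twice: it bounds the set defining \<omega> from below, and it supplies the
  hypothesis \<open>2 \<le> q\<close> of the recursive construction.\<close>

lemma ops_bigo_exponent_ge:
  fixes P :: "nat \<Rightarrow> 'a::comm_ring_1 slp"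
  assumes "mm_algorithm P" "ops_bigo P w"
  shows "2 \<le> w"
proof -
  have "n * n \<le> 2 * op_count (P n)" for n
    using assms(1) by (intro mm_slp_op_count_ge) (auto simp: mm_algorithm_def)
  then have "real (n * n) \<le> real (2 * op_count (P n))" for n
    by (rule of_nat_mono)
  then have "norm (real n powr 2) \<le> 2 * norm (real (op_count (P n)))" for n
    by (simp add: power2_eq_square)
  then have "(\<lambda>n. real n powr 2) \<in> O(\<lambda>n. real (op_count (P n)))"
    by (intro bigoI [where c = 2] always_eventually) blast
  also have "(\<lambda>n. real (op_count (P n))) \<in> O(\<lambda>n. real n powr w)"
    using assms(2) by (simp add: ops_bigo_def)
  finally show ?thesis
    by (simp only: powr_bigo_iff [OF filterlim_real_sequentially sequentially_bot])
qed

text \<open>The binary digits of \<open>r\<close> encode the triple \<open>(i, l, j)\<close> of the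
  product of \<open>a i l\<close> and \<open>b l j\<close>. This serves to show that some exponent
  is attained.\<close>

lemma bilinear_mm_standard:
  "bilinear_mm 2 8
     (\<lambda>r t. if t = 2 * (r div 4) + (r div 2) mod 2 then 1 else 0)
     (\<lambda>r t. if t = 2 * ((r div 2) mod 2) + r mod 2 then 1 else 0)
     (\<lambda>i j r. if i = r div 4 \<and> j = r mod 2 then 1 else (0 :: 'a::comm_ring_1))"
  unfolding bilinear_mm_def
  by (auto simp: lessThan_nat_numeral lessThan_Suc dest!: less_2_cases)

text \<open>The \<open>LEAST\<close> in the definition of \<omega> is meaningful because the set of
  admissible exponents is nonempty, bounded below and contains its infimum.\<close>

lemma mm_exponent_attained:
  assumes "\<eta> > 0"
  shows "\<exists>P :: nat \<Rightarrow> 'a::real_normed_field slp.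
    mm_algorithm P \<and> ops_bigo P (mm_exponent TYPE('a) + \<eta>)"
proof -
  define S where "S = {w. \<forall>\<eta>>0. \<exists>P :: nat \<Rightarrow> 'a slp. mm_algorithm P \<and> ops_bigo P (w + \<eta>)}"
  have S_iff: "w \<in> S \<longleftrightarrow> (\<forall>\<eta>>0. \<exists>P :: nat \<Rightarrow> 'a slp. mm_algorithm P \<and> ops_bigo P (w + \<eta>))" for w
    by (simp add: S_def)
  have bigo_mono: "ops_bigo P w'" if "ops_bigo P w" "w \<le> w'" for P :: "nat \<Rightarrow> 'a slp" and w w'
  proof -
    have "(\<lambda>n. real n powr w) \<in> O(\<lambda>n. real n powr w')"
      using that(2) by (simp add: powr_bigo_iff filterlim_real_sequentially)
    then show ?thesis
      using that(1) unfolding ops_bigo_def by (rule landau_o.big_trans [rotated])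
  qed
  have lower: "2 \<le> w" if "w \<in> S" for w
  proof (rule field_le_epsilon)
    fix e :: real assume "e > 0"
    then show "2 \<le> w + e"
      using that ops_bigo_exponent_ge unfolding S_iff by blast
  qed
  obtain P :: "nat \<Rightarrow> 'a slp" where P: "mm_algorithm P" "ops_bigo P 4"
    \<comment> \<open>The exponent 4 fits since \<open>2 * 8 = 2 ^ 4\<close>.\<close>
    using stable_algorithm_of_bilinear_mm [OF bilinear_mm_standard, of 4] by auto
  have "4 \<in> S"
    unfolding S_iff using P bigo_mono [OF P(2)] by (auto intro!: exI [of _ P])
  have bdd: "bdd_below S"
    using lower by (auto simp: bdd_below_def)
  have Inf: "Inf S \<in> S"
    unfolding S_iff
  proof (intro allI impI)
    fix \<eta> :: real assume \<eta>: "\<eta> > 0"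
    \<comment> \<open>Half of \<eta> is spent on approaching the infimum, the other half on the
      slack in the definition of \<open>S\<close>.\<close>
    then obtain w where w: "w \<in> S" "w < Inf S + \<eta> / 2"
      using cInf_lessD [of S "Inf S + \<eta> / 2"] \<open>4 \<in> S\<close> by auto
    then obtain Q :: "nat \<Rightarrow> 'a slp" where "mm_algorithm Q" "ops_bigo Q (w + \<eta> / 2)"
      using \<eta> half_gt_zero [OF \<eta>] unfolding S_iff by blast
    then show "\<exists>P :: nat \<Rightarrow> 'a slp. mm_algorithm P \<and> ops_bigo P (Inf S + \<eta>)"
      using w by (intro exI [of _ Q]) (auto elim: bigo_mono)
  qed
  have "mm_exponent TYPE('a) = (LEAST w. w \<in> S)"
    by (simp add: mm_exponent_def S_iff)
  also have "\<dots> = Inf S"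
    using Inf bdd by (intro Least_equality) (auto intro: cInf_lower)
  finally have "mm_exponent TYPE('a) \<in> S"
    using Inf by simp
  then show ?thesis
    using assms by (simp add: S_iff)
qed

text \<open>A fast algorithm is used only at one fixed dimension \<open>m\<close>, to extract a
  bilinear algorithm; stability comes from the recursion, not from the given programs.\<close>

lemma stable_mm_algorithm_exists:
  assumes "\<eta> > 0"
  shows "\<exists>P :: nat \<Rightarrow> 'a::real_normed_field slp.
    mm_algorithm P \<and> ops_bigo P (mm_exponent TYPE('a) + \<eta>) \<and> numerically_stable P"
proof -
  let ?\<omega> = "mm_exponent TYPE('a)"
  have "\<eta> / 2 > 0"
    using assms by simp
  from mm_exponent_attained [OF this, where 'a = 'a]
  obtain P :: "nat \<Rightarrow> 'a slp" where P: "mm_algorithm P" "ops_bigo P (?\<omega> + \<eta> / 2)"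
    by blast
  have "(\<lambda>n. real (op_count (P n))) \<in> o(\<lambda>n. real n powr (?\<omega> + \<eta>))"
    using P(2) unfolding ops_bigo_def
    by (rule landau_o.big_small_trans)
      (use assms in \<open>simp add: powr_smallo_iff filterlim_real_sequentially\<close>)
  \<comment> \<open>The constant \<open>1 / 4\<close> pays for two products per instruction and for
    the factor 2 in the hypothesis on \<open>R\<close>.\<close>
  from landau_o.smallD [OF this, of "1 / 4"]
  have "\<forall>\<^sub>F n in sequentially. real (op_count (P n)) \<le> 1 / 4 * real n powr (?\<omega> + \<eta>)"
    by simp
  then have "\<forall>\<^sub>F n in sequentially. 2 \<le> n \<and> real (op_count (P n)) \<le> 1 / 4 * real n powr (?\<omega> + \<eta>)"
    using eventually_ge_at_top [of 2] by eventually_elim simp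
  then obtain m where m: "2 \<le> m" "real (op_count (P m)) \<le> 1 / 4 * real m powr (?\<omega> + \<eta>)"
    by (auto simp: eventually_sequentially)
  obtain u v and w :: "nat \<Rightarrow> nat \<Rightarrow> nat \<Rightarrow> 'a" where bil: "bilinear_mm m (2 * op_count (P m)) u v w"
    using bilinear_mm_of_slp [of m "P m"] P(1) by (auto simp: mm_algorithm_def)
  have R: "2 * real (2 * op_count (P m)) \<le> real m powr (?\<omega> + \<eta>)"
    using m(2) by simp
  have "2 \<le> ?\<omega> + \<eta> / 2"
    using ops_bigo_exponent_ge [OF P] .
  then show ?thesis
    using assms by (intro stable_algorithm_of_bilinear_mm [OF bil m(1) _ R]) auto
qed

theorem theorem3p3:
  fixes \<eta> :: real
  assumes "\<eta> > 0"
  shows "(\<exists>P :: nat \<Rightarrow> real slp.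
            mm_algorithm P \<and> ops_bigo P (mm_exponent TYPE(real) + \<eta>) \<and> numerically_stable P) \<and>
         (\<exists>P :: nat \<Rightarrow> complex slp.
            mm_algorithm P \<and> ops_bigo P (mm_exponent TYPE(complex) + \<eta>) \<and> numerically_stable P)"
  by (intro conjI stable_mm_algorithm_exists assms)

end
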